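(* Let $X$ be an $n$-dimensional complex analytic manifold and $D\subset X$ a free divisor given by a global reduced equation $f:X\to\mathbb{C}$. Assume that the complex $\mathcal{D}_X[s]\otimes_{\mathrm{U}\Theta_{f,s}}\mathrm{Sp}_{\Theta_{f,s}}\mathcal{O}_X$ is concentrated in degree $0$, i.e. it is a resolution of the left $\mathcal{D}_X[s]$-module $\mathcal{D}_X[s]/\mathcal{D}_X[s]\cdot\Theta_{f,s}$. Then the following properties are equivalent: (a) The complex $\mathcal{D}_X\otimes_{\mathcal{V}_0}\mathrm{Sp}\,\mathcal{O}_X$ is exact in degree $-1$. (b) The module $\mathcal{D}_X[s]/\mathcal{D}_X[s]\cdot\Theta_{f,s}$ has no $s$-torsion. (c) The divisor $D$ is pre-Spencer.
   Context: $\mathcal{O}_X$ is the sheaf of holomorphic functions, $\mathcal{D}_X$ the sheaf of holomorphic linear differential operators, $\mathcal{D}_X[s]$ the polynomial ring in a central variable $s$. A holomorphic vector field $\delta$ is logarithmic along the hypersurface $D$ if it preserves the ideal of $D$; $\mathrm{Der}(\log D)$ is the sheaf of logarithmic vector fields. $D$ is a free divisor if $\mathrm{Der}(\log D)$ is a locally free $\mathcal{O}_X$-module (of rank $n$). $\Theta_{f,s}\subset\mathcal{D}_X[s]$ is the $\mathcal{O}_X$-submodule of operators $\delta-\alpha s$ with $\delta$ a holomorphic vector field, $\alpha\in\mathcal{O}_X$ and $\delta(f)=\alpha f$. It is closed under commutators in $\mathcal{D}_X[s]$, and $\delta\mapsto\delta-\frac{\delta(f)}{f}s$ is an isomorphism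 $\mathrm{Der}(\log D)\simeq\Theta_{f,s}$ of $\mathcal{O}_X$-modules and of sheaves of Lie algebras. A Lie algebroid on $X$ is an $\mathcal{O}_X$-module $\mathcal{L}$ with a structure of sheaf of $\mathbb{C}$-Lie algebras and an $\mathcal{O}_X$-linear Lie algebra morphism (anchor) $\rho:\mathcal{L}\to\mathrm{Der}_{\mathbb{C}}(\mathcal{O}_X)$ with $[\lambda,g\lambda']=g[\lambda,\lambda']+\rho(\lambda)(g)\lambda'$. $\mathrm{Der}(\log D)$ (anchor the inclusion) and $\Theta_{f,s}$ (anchor $\delta-\alpha s\mapsto\delta$) are Lie algebroids. $\mathrm{U}\mathcal{L}$ is the enveloping algebra: the universal ring containing $\mathcal{O}_X$ and receiving an $\mathcal{O}_X$-linear, bracket-preserving map from $\mathcal{L}$ with $\lambda g=g\lambda+\rho(\lambda)(g)$. $\mathcal{O}_X$ is a left $\mathrm{U}\mathcal{L}$-module through the anchor. For $D$ free, $\mathrm{U}\,\mathrm{Der}(\log D)$ is canonically the sheaf of rings $\mathcal{V}_0=\mathcal{D}_X(\log D)$ of logarithmic differential operators, i.e. those $P\in\mathcal{D}_X$ with $P(\mathcal{I}_D^m)\subset\mathcal{I}_D^m$ for all $m$ ($\mathcal{I}_D$ the ideal of $D$). The inclusion $\Theta_{f,s}\subset\mathcal{D}_X[s]$ induces a ring morphism $\mathrm{U}\Theta_{f,s}\to\mathcal{D}_X[s]$. For $\mathcal{L}$ locally free of finite rank, the Spencer complex $\mathrm{Sp}_{\mathcal{L}}\mathcal{O}_X$ is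 the complex of left $\mathrm{U}\mathcal{L}$-modules with $\mathrm{U}\mathcal{L}\otimes_{\mathcal{O}_X}\bigwedge^r\mathcal{L}$ in degree $-r$ ($r\ge 0$) and differential $$P\otimes(\lambda_1\wedge\cdots\wedge\lambda_r)\mapsto\sum_{i}(-1)^{i-1}P\lambda_i\otimes(\lambda_1\wedge\cdots\widehat{\lambda_i}\cdots\wedge\lambda_r)+\sum_{i<j}(-1)^{i+j}P\otimes([\lambda_i,\lambda_j]\wedge\lambda_1\wedge\cdots\widehat{\lambda_i}\cdots\widehat{\lambda_j}\cdots\wedge\lambda_r).$$ One writes $\mathrm{Sp}\,\mathcal{O}_X=\mathrm{Sp}_{\mathrm{Der}(\log D)}\mathcal{O}_X$. Thus $\mathcal{D}_X\otimes_{\mathcal{V}_0}\mathrm{Sp}\,\mathcal{O}_X$ has terms $\mathcal{D}_X\otimes_{\mathcal{O}_X}\bigwedge^r\mathrm{Der}(\log D)$, and $\mathcal{D}_X[s]\otimes_{\mathrm{U}\Theta_{f,s}}\mathrm{Sp}_{\Theta_{f,s}}\mathcal{O}_X$ has terms $\mathcal{D}_X[s]\otimes_{\mathcal{O}_X}\bigwedge^r\Theta_{f,s}$, with the same formula for the differential. A complex is concentrated in degree $0$ if its cohomology vanishes in all degrees $\ne0$; it is exact in degree $-1$ if $h^{-1}=0$. The free divisor $D$ is pre-Spencer if $\mathcal{D}_X\otimes_{\mathcal{V}_0}\mathrm{Sp}\,\mathcal{O}_X$ is concentrated in degree $0$. A module has no $s$-torsion if multiplication by $s$ on it is injective. *)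

theory Defs
  imports "HOL-Analysis.Analysis" "HOL-Algebra.UnivPoly" "HOL-Algebra.Generated_Rings"
    "HOL-Algebra.Free_Abelian_Groups"
begin

section \<open>Complex manifolds and germs of holomorphic functions\<close>

definition holomorphic_in :: "(complex ^ 'n) set \<Rightarrow> (complex ^ 'n \<Rightarrow> complex) \<Rightarrow> bool" where
  "holomorphic_in S F \<longleftrightarrow>
     (\<forall>z\<in>S. \<exists>F'. (F has_derivative F') (at z) \<and> (\<forall>c v. F' (c *s v) = c * F' v))"

type_synonym ('a, 'n) chart = "'a set \<times> ('a \<Rightarrow> complex ^ 'n)"

definition complex_manifold :: "'a topology \<Rightarrow> ('a, 'n::finite) chart set \<Rightarrow> bool" where
  "complex_manifold X A \<longleftrightarrow>
     Hausdorff_space X \<and> second_countable X \<and>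
     topspace X = (\<Union>(V, \<phi>)\<in>A. V) \<and>
     (\<forall>(V, \<phi>)\<in>A. openin X V \<and> open (\<phi> ` V) \<and>
        homeomorphic_map (subtopology X V) (top_of_set (\<phi> ` V)) \<phi>) \<and>
     (\<forall>(V, \<phi>)\<in>A. \<forall>(W, \<psi>)\<in>A. \<forall>i.
        holomorphic_in (\<phi> ` (V \<inter> W)) (\<lambda>z. \<psi> (inv_into V \<phi> z) $ i))"

text \<open>
  A holomorphic function on an open set \<open>U\<close> is given by a total function on the point type,
  whose values outside \<open>U\<close> are irrelevant.
\<close>

definition hol :: "'a topology \<Rightarrow> ('a, 'n::finite) chart set \<Rightarrow> 'a set \<Rightarrow> ('a \<Rightarrow> complex) set" where
  "hol X A U = {g. \<forall>(V, \<phi>)\<in>A. holomorphic_in (\<phi> ` (U \<inter> V)) (g \<circ> inv_into V \<phi>)}"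

type_synonym 'a germ = "('a \<Rightarrow> complex) set"

definition germ :: "'a topology \<Rightarrow> 'a \<Rightarrow> ('a \<Rightarrow> complex) \<Rightarrow> 'a germ" where
  "germ X p g = {h. eventually (\<lambda>x. h x = g x) (nhdsin X p)}"

definition O_stalk :: "'a topology \<Rightarrow> ('a, 'n::finite) chart set \<Rightarrow> 'a \<Rightarrow> 'a germ ring" where
  "O_stalk X A p = \<lparr>
     carrier = {germ X p g | g U. openin X U \<and> p \<in> U \<and> g \<in> hol X A U},
     monoid.mult = (\<lambda>a b. {k. \<exists>g\<in>a. \<exists>h\<in>b. eventually (\<lambda>x. k x = g x * h x) (nhdsin X p)}),
     one = germ X p (\<lambda>_. 1),
     ring.zero = germ X p (\<lambda>_. 0),
     ring.add = (\<lambda>a b. {k. \<exists>g\<in>a. \<exists>h\<in>b. eventually (\<lambda>x. k x = g x + h x) (nhdsin X p)})\<rparr>"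


section \<open>Vector fields and differential operators\<close>

text \<open>
  The ring of \<open>\<complex>\<close>-linear endomorphisms of the stalk of the structure sheaf at \<open>p\<close>.
\<close>

definition End_stalk ::
    "'a topology \<Rightarrow> ('a, 'n::finite) chart set \<Rightarrow> 'a \<Rightarrow> ('a germ \<Rightarrow> 'a germ) ring" where
  "End_stalk X A p = (let R = O_stalk X A p in \<lparr>
     carrier = {P \<in> carrier R \<rightarrow>\<^sub>E carrier R.
        (\<forall>a\<in>carrier R. \<forall>b\<in>carrier R. P (a \<oplus>\<^bsub>R\<^esub> b) = P a \<oplus>\<^bsub>R\<^esub> P b) \<and>
        (\<forall>c. \<forall>a\<in>carrier R. P (germ X p (\<lambda>_. c) \<otimes>\<^bsub>R\<^esub> a) = germ X p (\<lambda>_. c) \<otimes>\<^bsub>R\<^esub> P a)},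
     monoid.mult = (\<lambda>P Q. compose (carrier R) P Q),
     one = (\<lambda>a\<in>carrier R. a),
     ring.zero = (\<lambda>a\<in>carrier R. \<zero>\<^bsub>R\<^esub>),
     ring.add = (\<lambda>P Q. \<lambda>a\<in>carrier R. P a \<oplus>\<^bsub>R\<^esub> Q a)\<rparr>)"

definition mult_op ::
    "'a topology \<Rightarrow> ('a, 'n::finite) chart set \<Rightarrow> 'a \<Rightarrow> 'a germ \<Rightarrow> 'a germ \<Rightarrow> 'a germ" where
  "mult_op X A p a = (\<lambda>b\<in>carrier (O_stalk X A p). a \<otimes>\<^bsub>O_stalk X A p\<^esub> b)"

definition derivation_at ::
    "'a topology \<Rightarrow> ('a, 'n::finite) chart set \<Rightarrow> 'a \<Rightarrow> ('a germ \<Rightarrow> 'a germ) \<Rightarrow> bool" where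
  "derivation_at X A p \<delta> \<longleftrightarrow> \<delta> \<in> carrier (End_stalk X A p) \<and>
     (let R = O_stalk X A p in \<forall>a\<in>carrier R. \<forall>b\<in>carrier R.
        \<delta> (a \<otimes>\<^bsub>R\<^esub> b) = \<delta> a \<otimes>\<^bsub>R\<^esub> b \<oplus>\<^bsub>R\<^esub> a \<otimes>\<^bsub>R\<^esub> \<delta> b)"

text \<open>
  A section over \<open>U\<close> of the sheaf of \<open>\<complex>\<close>-derivations of the structure sheaf is described by its
  action on the stalks: a family \<open>\<delta> q\<close> (\<open>q \<in> U\<close>) of derivations of the stalks that sends sections
  over open subsets of \<open>U\<close> to sections, i.e. that comes from a morphism of sheaves over \<open>U\<close>.
\<close>

definition vector_field ::
    "'a topology \<Rightarrow> ('a, 'n::finite) chart set \<Rightarrow> 'a set \<Rightarrow> ('a \<Rightarrow> 'a germ \<Rightarrow> 'a germ) \<Rightarrow> bool" where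
  "vector_field X A U \<delta> \<longleftrightarrow>
     (\<forall>q\<in>U. derivation_at X A q (\<delta> q)) \<and>
     (\<forall>V g. openin X V \<and> V \<subseteq> U \<and> g \<in> hol X A V \<longrightarrow>
        (\<exists>h\<in>hol X A V. \<forall>q\<in>V. \<delta> q (germ X q g) = germ X q h))"

text \<open>
  A germ of a vector field at \<open>p\<close> is determined by the operator it induces on the stalk of
  functions at \<open>p\<close>; stalks of sheaves of operators are therefore realised inside \<^const>\<open>End_stalk\<close>.
\<close>

definition Der_stalk ::
    "'a topology \<Rightarrow> ('a, 'n::finite) chart set \<Rightarrow> 'a \<Rightarrow> ('a germ \<Rightarrow> 'a germ) set" where
  "Der_stalk X A p = {\<delta> p | \<delta> U. openin X U \<and> p \<in> U \<and> vector_field X A U \<delta>}"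

text \<open>
  The sheaf of differential operators is the sheaf of subrings of the \<open>\<complex>\<close>-linear endomorphisms of
  the structure sheaf generated by functions and vector fields.
\<close>

definition D_stalk ::
    "'a topology \<Rightarrow> ('a, 'n::finite) chart set \<Rightarrow> 'a \<Rightarrow> ('a germ \<Rightarrow> 'a germ) ring" where
  "D_stalk X A p = (End_stalk X A p)
     \<lparr>carrier := generate_ring (End_stalk X A p)
        (mult_op X A p ` carrier (O_stalk X A p) \<union> Der_stalk X A p)\<rparr>"

abbreviation Ds_stalk ::
    "'a topology \<Rightarrow> ('a, 'n::finite) chart set \<Rightarrow> 'a
       \<Rightarrow> ('a germ \<Rightarrow> 'a germ, nat \<Rightarrow> 'a germ \<Rightarrow> 'a germ) up_ring" where
  "Ds_stalk X A p \<equiv> UP (D_stalk X A p)"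

definition s_elem ::
    "'a topology \<Rightarrow> ('a, 'n::finite) chart set \<Rightarrow> 'a \<Rightarrow> nat \<Rightarrow> 'a germ \<Rightarrow> 'a germ" where
  "s_elem X A p = monom (Ds_stalk X A p) \<one>\<^bsub>D_stalk X A p\<^esub> 1"

definition const_s ::
    "'a topology \<Rightarrow> ('a, 'n::finite) chart set \<Rightarrow> 'a \<Rightarrow> ('a germ \<Rightarrow> 'a germ)
       \<Rightarrow> nat \<Rightarrow> 'a germ \<Rightarrow> 'a germ" where
  "const_s X A p P = monom (Ds_stalk X A p) P 0"


section \<open>Hypersurfaces, logarithmic vector fields and free divisors\<close>

definition hypersurface :: "'a topology \<Rightarrow> ('a, 'n::finite) chart set \<Rightarrow> 'a set \<Rightarrow> bool" where
  "hypersurface X A D \<longleftrightarrow> D \<subseteq> topspace X \<and>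
     (\<forall>p\<in>topspace X. \<exists>U h. openin X U \<and> p \<in> U \<and> h \<in> hol X A U \<and> D \<inter> U = {x\<in>U. h x = 0} \<and>
        (\<forall>q\<in>U. germ X q h \<noteq> \<zero>\<^bsub>O_stalk X A q\<^esub>))"

definition ideal_stalk ::
    "'a topology \<Rightarrow> ('a, 'n::finite) chart set \<Rightarrow> 'a set \<Rightarrow> 'a \<Rightarrow> 'a germ set" where
  "ideal_stalk X A D p =
     {germ X p g | g U. openin X U \<and> p \<in> U \<and> g \<in> hol X A U \<and> (\<forall>x\<in>D \<inter> U. g x = 0)}"

definition log_vector_field ::
    "'a topology \<Rightarrow> ('a, 'n::finite) chart set \<Rightarrow> 'a set \<Rightarrow> 'a set
       \<Rightarrow> ('a \<Rightarrow> 'a germ \<Rightarrow> 'a germ) \<Rightarrow> bool" where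
  "log_vector_field X A D U \<delta> \<longleftrightarrow> vector_field X A U \<delta> \<and>
     (\<forall>q\<in>U. \<delta> q ` ideal_stalk X A D q \<subseteq> ideal_stalk X A D q)"

definition Der_log_stalk ::
    "'a topology \<Rightarrow> ('a, 'n::finite) chart set \<Rightarrow> 'a set \<Rightarrow> 'a \<Rightarrow> ('a germ \<Rightarrow> 'a germ) set" where
  "Der_log_stalk X A D p = {\<delta> p | \<delta> U. openin X U \<and> p \<in> U \<and> log_vector_field X A D U \<delta>}"

text \<open>
  Locally free of rank \<open>n = CARD('n)\<close>: near every point there are \<open>n\<close> logarithmic vector fields
  such that the induced morphism from the free module of rank \<open>n\<close> is an isomorphism of sheaves,
  i.e. is bijective on stalks.
\<close>

definition free_divisor :: "'a topology \<Rightarrow> ('a, 'n::finite) chart set \<Rightarrow> 'a set \<Rightarrow> bool" where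
  "free_divisor X A D \<longleftrightarrow> hypersurface X A D \<and>
     (\<forall>p\<in>topspace X. \<exists>U (d :: 'n \<Rightarrow> 'a \<Rightarrow> 'a germ \<Rightarrow> 'a germ).
        openin X U \<and> p \<in> U \<and> (\<forall>i. log_vector_field X A D U (d i)) \<and>
        (\<forall>q\<in>U. \<forall>\<eta>\<in>Der_log_stalk X A D q. \<exists>!c. (\<forall>i. c i \<in> carrier (O_stalk X A q)) \<and>
           \<eta> = (\<Oplus>\<^bsub>End_stalk X A q\<^esub>i\<in>UNIV. mult_op X A q (c i) \<otimes>\<^bsub>End_stalk X A q\<^esub> d i q)))"

definition reduced_equation ::
    "'a topology \<Rightarrow> ('a, 'n::finite) chart set \<Rightarrow> 'a set \<Rightarrow> ('a \<Rightarrow> complex) \<Rightarrow> bool" where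
  "reduced_equation X A D f \<longleftrightarrow> f \<in> hol X A (topspace X) \<and> D = {x\<in>topspace X. f x = 0} \<and>
     (\<forall>p\<in>topspace X. ideal_stalk X A D p = PIdl\<^bsub>O_stalk X A p\<^esub> (germ X p f))"

definition Theta_stalk ::
    "'a topology \<Rightarrow> ('a, 'n::finite) chart set \<Rightarrow> ('a \<Rightarrow> complex) \<Rightarrow> 'a
       \<Rightarrow> (nat \<Rightarrow> 'a germ \<Rightarrow> 'a germ) set" where
  "Theta_stalk X A f p =
     {const_s X A p \<delta> \<ominus>\<^bsub>Ds_stalk X A p\<^esub>
        const_s X A p (mult_op X A p \<alpha>) \<otimes>\<^bsub>Ds_stalk X A p\<^esub> s_elem X A p | \<delta> \<alpha>.
      \<delta> \<in> Der_stalk X A p \<and> \<alpha> \<in> carrier (O_stalk X A p) \<and>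
      \<delta> (germ X p f) = \<alpha> \<otimes>\<^bsub>O_stalk X A p\<^esub> germ X p f}"


section \<open>Spencer complexes\<close>

text \<open>
  Let \<open>B\<close> be a ring, \<open>R\<close> a commutative subring of \<open>B\<close>, and \<open>L\<close> a left \<open>R\<close>-submodule of \<open>B\<close> that is
  closed under commutators and whose commutators with \<open>R\<close> lie in \<open>R\<close>. The group
  \<open>spencer_term B R L r\<close> is \<open>B \<otimes>\<^sub>R \<And>\<^sup>r L\<close> (exterior power over \<open>R\<close>), presented by the generators
  \<open>P \<otimes> (x\<^sub>1 \<and> \<dots> \<and> x\<^sub>r)\<close>, encoded as \<open>(P, [x\<^sub>1, \<dots>, x\<^sub>r])\<close>, and the relations: additivity in \<open>P\<close>,
  additivity in each \<open>x\<^sub>i\<close>, \<open>P a \<otimes> (x\<^sub>1 \<and> \<dots>) = P \<otimes> (\<dots> \<and> a x\<^sub>i \<and> \<dots>)\<close> for \<open>a \<in> R\<close>, and vanishing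
  when two of the \<open>x\<^sub>i\<close> coincide.
\<close>

definition spencer_gens :: "('b, 'm) ring_scheme \<Rightarrow> 'b set \<Rightarrow> nat \<Rightarrow> ('b \<times> 'b list) set" where
  "spencer_gens B L r = carrier B \<times> {xs. length xs = r \<and> set xs \<subseteq> L}"

definition spencer_rels ::
    "('b, 'm) ring_scheme \<Rightarrow> 'b set \<Rightarrow> 'b set \<Rightarrow> nat \<Rightarrow> (('b \<times> 'b list) \<Rightarrow>\<^sub>0 int) set" where
  "spencer_rels B R L r =
     {frag_of (P \<oplus>\<^bsub>B\<^esub> Q, xs) - frag_of (P, xs) - frag_of (Q, xs) | P Q xs.
        (P, xs) \<in> spencer_gens B L r \<and> Q \<in> carrier B} \<union>
     {frag_of (P, xs[i := x \<oplus>\<^bsub>B\<^esub> y]) - frag_of (P, xs[i := x]) - frag_of (P, xs[i := y]) | P xs i x y.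
        (P, xs) \<in> spencer_gens B L r \<and> i < r \<and> x \<in> L \<and> y \<in> L} \<union>
     {frag_of (P \<otimes>\<^bsub>B\<^esub> a, xs) - frag_of (P, xs[i := a \<otimes>\<^bsub>B\<^esub> (xs ! i)]) | P a xs i.
        (P, xs) \<in> spencer_gens B L r \<and> i < r \<and> a \<in> R} \<union>
     {frag_of (P, xs) | P xs i j.
        (P, xs) \<in> spencer_gens B L r \<and> i < j \<and> j < r \<and> xs ! i = xs ! j}"

definition spencer_rel_group ::
    "('b, 'm) ring_scheme \<Rightarrow> 'b set \<Rightarrow> 'b set \<Rightarrow> nat \<Rightarrow> (('b \<times> 'b list) \<Rightarrow>\<^sub>0 int) set" where
  "spencer_rel_group B R L r =
     generate (free_Abelian_group (spencer_gens B L r)) (spencer_rels B R L r)"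

definition spencer_term ::
    "('b, 'm) ring_scheme \<Rightarrow> 'b set \<Rightarrow> 'b set \<Rightarrow> nat \<Rightarrow> (('b \<times> 'b list) \<Rightarrow>\<^sub>0 int) set monoid" where
  "spencer_term B R L r =
     free_Abelian_group (spencer_gens B L r) Mod spencer_rel_group B R L r"

text \<open>
  Indices of list entries start at \<open>0\<close> instead of \<open>1\<close>: this turns \<open>(-1)\<^bsup>i-1\<^esup>\<close> into \<open>(-1)\<^bsup>i\<^esup>\<close> and
  preserves \<open>(-1)\<^bsup>i+j\<^esup>\<close>.
\<close>

definition spencer_diff_gen ::
    "('b, 'm) ring_scheme \<Rightarrow> 'b \<times> 'b list \<Rightarrow> (('b \<times> 'b list) \<Rightarrow>\<^sub>0 int)" where
  "spencer_diff_gen B = (\<lambda>(P, xs).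
     (\<Sum>i<length xs. frag_cmul ((-1) ^ i) (frag_of (P \<otimes>\<^bsub>B\<^esub> (xs ! i), nths xs (- {i})))) +
     (\<Sum>j<length xs. \<Sum>i<j. frag_cmul ((-1) ^ (i + j))
        (frag_of (P, ((xs ! i) \<otimes>\<^bsub>B\<^esub> (xs ! j) \<ominus>\<^bsub>B\<^esub> (xs ! j) \<otimes>\<^bsub>B\<^esub> (xs ! i)) # nths xs (- {i, j})))))"

text \<open>The differential from degree \<open>-r\<close> to degree \<open>-(r-1)\<close>, for \<open>r \<ge> 1\<close>.\<close>

definition spencer_diff ::
    "('b, 'm) ring_scheme \<Rightarrow> 'b set \<Rightarrow> 'b set \<Rightarrow> nat
       \<Rightarrow> (('b \<times> 'b list) \<Rightarrow>\<^sub>0 int) set \<Rightarrow> (('b \<times> 'b list) \<Rightarrow>\<^sub>0 int) set" where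
  "spencer_diff B R L r C =
     (\<Union>z\<in>C. spencer_rel_group B R L (r - 1)
        #>\<^bsub>free_Abelian_group (spencer_gens B L (r - 1))\<^esub> frag_extend (spencer_diff_gen B) z)"

text \<open>Vanishing of the cohomology in degree \<open>-r\<close>, for \<open>r \<ge> 1\<close>.\<close>

definition spencer_exact :: "('b, 'm) ring_scheme \<Rightarrow> 'b set \<Rightarrow> 'b set \<Rightarrow> nat \<Rightarrow> bool" where
  "spencer_exact B R L r \<longleftrightarrow>
     kernel (spencer_term B R L r) (spencer_term B R L (r - 1)) (spencer_diff B R L r) =
     spencer_diff B R L (r + 1) ` carrier (spencer_term B R L (r + 1))"

text \<open>
  The two complexes in question. Cohomology sheaves vanish iff their stalks do, and the stalk at \<open>p\<close>
  of the complex is the complex formed from the stalks.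
\<close>

definition log_spencer_exact ::
    "'a topology \<Rightarrow> ('a, 'n::finite) chart set \<Rightarrow> 'a set \<Rightarrow> nat \<Rightarrow> bool" where
  "log_spencer_exact X A D r \<longleftrightarrow> (\<forall>p\<in>topspace X.
     spencer_exact (D_stalk X A p) (mult_op X A p ` carrier (O_stalk X A p)) (Der_log_stalk X A D p) r)"

definition Theta_spencer_exact ::
    "'a topology \<Rightarrow> ('a, 'n::finite) chart set \<Rightarrow> ('a \<Rightarrow> complex) \<Rightarrow> nat \<Rightarrow> bool" where
  "Theta_spencer_exact X A f r \<longleftrightarrow> (\<forall>p\<in>topspace X.
     spencer_exact (Ds_stalk X A p)
       ((\<lambda>a. const_s X A p (mult_op X A p a)) ` carrier (O_stalk X A p)) (Theta_stalk X A f p) r)"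

definition pre_Spencer :: "'a topology \<Rightarrow> ('a, 'n::finite) chart set \<Rightarrow> 'a set \<Rightarrow> bool" where
  "pre_Spencer X A D \<longleftrightarrow> free_divisor X A D \<and> (\<forall>r\<ge>1. log_spencer_exact X A D r)"


section \<open>Torsion\<close>

definition left_ideal_gen :: "('b, 'm) ring_scheme \<Rightarrow> 'b set \<Rightarrow> 'b set" where
  "left_ideal_gen B S = generate (add_monoid B) {P \<otimes>\<^bsub>B\<^esub> x | P x. P \<in> carrier B \<and> x \<in> S}"

text \<open>
  For a left ideal \<open>I\<close> and a central element \<open>s\<close> of \<open>B\<close>: multiplication by \<open>s\<close> on the left module
  \<open>B / I\<close> is injective.
\<close>

definition no_torsion :: "('b, 'm) ring_scheme \<Rightarrow> 'b set \<Rightarrow> 'b \<Rightarrow> bool" where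
  "no_torsion B I s \<longleftrightarrow>
     inj_on (\<lambda>C. \<Union>c\<in>C. I +>\<^bsub>B\<^esub> (s \<otimes>\<^bsub>B\<^esub> c)) (carrier (add_monoid B Mod I))"

definition no_s_torsion ::
    "'a topology \<Rightarrow> ('a, 'n::finite) chart set \<Rightarrow> ('a \<Rightarrow> complex) \<Rightarrow> bool" where
  "no_s_torsion X A f \<longleftrightarrow> (\<forall>p\<in>topspace X.
     no_torsion (Ds_stalk X A p) (left_ideal_gen (Ds_stalk X A p) (Theta_stalk X A f p))
       (s_elem X A p))"

end

theory Submission
  imports Defs
begin

text \<open>
  Fix a point and write \<open>\<D>\<close> for the stalk of the differential operators. Let \<open>C\<^sub>s\<close> be the complex with
  terms \<open>\<D>[s] \<otimes> \<And>\<^sup>r \<Theta>\<close> and \<open>C\<close> the logarithmic complex with terms \<open>\<D> \<otimes> \<And>\<^sup>r Der(log D)\<close>. Setting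
  \<open>s = 0\<close> sends \<open>\<delta> - \<alpha> s\<close> to \<open>\<delta>\<close>; this identifies \<open>\<Theta>\<close> with the logarithmic vector fields and makes
  \<open>0 \<rightarrow> C\<^sub>s \<rightarrow> C\<^sub>s \<rightarrow> C \<rightarrow> 0\<close>, whose first map is multiplication by \<open>s\<close>, an exact sequence of
  complexes. If \<open>C\<^sub>s\<close> has no cohomology in degrees \<open>-r\<close> with \<open>r \<ge> 1\<close>, the long exact sequence gives
  \<open>h\<^sup>-\<^sup>r(C) = 0\<close> for \<open>r \<ge> 2\<close>, and identifies \<open>h\<^sup>-\<^sup>1(C)\<close> with the kernel of multiplication by \<open>s\<close> on
  \<open>h\<^sup>0(C\<^sub>s) = \<D>[s]/\<D>[s]\<Theta>\<close>. So exactness in degree \<open>-1\<close>, absence of \<open>s\<close>-torsion and exactness in all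
  negative degrees are the same condition.

  The exactness of the short sequence is seen on generators and relations. The division by \<open>s\<close> that
  discards the constant coefficient, and the inclusion of constant polynomials, both respect the
  relations; the first is a left inverse of multiplication by \<open>s\<close> (\<open>\<sigma>_s_chain\<close>), and every chain is
  its constant part plus \<open>s\<close> times its quotient (\<open>decomp_chain\<close>). These maps form the locale
  \<open>s_deformation\<close>, in which the connecting map is traced by hand
  (\<open>exact_B_if_s_regular\<close>, \<open>s_regular_if_exact_B\<close>).

  That the Spencer differential respects the relations and squares to zero is not computed, except
  in the trivial degree \<open>-1\<close>. Exactness in degree \<open>-r\<close>, stated for maps between sets of cosets,
  equates the image of the next differential with a set of cosets killed by the present one, so
  both facts for \<open>C\<^sub>s\<close> are part of the assumption (\<open>spencer_exact_iff\<close>); they descend to \<open>C\<close> along the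
  surjection \<open>s = 0\<close>.

  The geometry enters through \<open>s_deformation_stalk\<close>: a germ \<open>\<delta>\<close> with \<open>\<delta>(f) = \<alpha> f\<close> is logarithmic on a whole
  neighbourhood because \<open>f\<close> generates the ideal of \<open>D\<close> at every point, and \<open>\<delta>\<close> determines \<open>\<alpha>\<close> because
  \<open>D\<close> has empty interior, which makes \<open>f\<close> a non-zero-divisor.
\<close>


section \<open>The terms of a Spencer complex and exactness on chains\<close>

definition spencer_chains :: "('b, 'm) ring_scheme \<Rightarrow> 'b set \<Rightarrow> nat \<Rightarrow> (('b \<times> 'b list) \<Rightarrow>\<^sub>0 int) set" where
  "spencer_chains B L r = {z. Poly_Mapping.keys z \<subseteq> spencer_gens B L r}"

abbreviation chain_diff ::
    "('b, 'm) ring_scheme \<Rightarrow> (('b \<times> 'b list) \<Rightarrow>\<^sub>0 int) \<Rightarrow> (('b \<times> 'b list) \<Rightarrow>\<^sub>0 int)" where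
  "chain_diff B \<equiv> frag_extend (spencer_diff_gen B)"

definition chain_map ::
    "('b \<Rightarrow> 'c) \<Rightarrow> ('b \<Rightarrow> 'c) \<Rightarrow> (('b \<times> 'b list) \<Rightarrow>\<^sub>0 int) \<Rightarrow> (('c \<times> 'c list) \<Rightarrow>\<^sub>0 int)" where
  "chain_map \<phi> \<psi> = frag_extend (\<lambda>(P, xs). frag_of (\<phi> P, map \<psi> xs))"

lemma carrier_free_chains:
  "carrier (free_Abelian_group (spencer_gens B L r)) = spencer_chains B L r"
  by (auto simp: spencer_chains_def)

lemma spencer_chains_zero [simp]: "0 \<in> spencer_chains B L r"
  by (simp add: spencer_chains_def)

lemma spencer_chains_diff:
  "x \<in> spencer_chains B L r \<Longrightarrow> y \<in> spencer_chains B L r \<Longrightarrow> x - y \<in> spencer_chains B L r"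
  using keys_diff[of x y] unfolding spencer_chains_def by blast

lemma spencer_chains_add:
  "x \<in> spencer_chains B L r \<Longrightarrow> y \<in> spencer_chains B L r \<Longrightarrow> x + y \<in> spencer_chains B L r"
  using Poly_Mapping.keys_add[of x y] unfolding spencer_chains_def by blast

lemma spencer_chains_of [simp]:
  "frag_of g \<in> spencer_chains B L r \<longleftrightarrow> g \<in> spencer_gens B L r"
  by (simp add: spencer_chains_def)

lemma spencer_chains_induct [consumes 1, case_names zero gen diff]:
  assumes "z \<in> spencer_chains B L r" "Q 0"
    and "\<And>P xs. P \<in> carrier B \<Longrightarrow> length xs = r \<Longrightarrow> set xs \<subseteq> L \<Longrightarrow> Q (frag_of (P, xs))"
    and "\<And>x y. x \<in> spencer_chains B L r \<Longrightarrow> y \<in> spencer_chains B L r \<Longrightarrow> Q x \<Longrightarrow> Q y \<Longrightarrow> Q (x - y)"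
  shows "Q z"
proof (rule free_Abelian_group_induct[of z "spencer_gens B L r"])
  show "Poly_Mapping.keys z \<subseteq> spencer_gens B L r"
    using assms(1) by (simp add: spencer_chains_def)
  show "Q (frag_of a)" if "a \<in> spencer_gens B L r" for a
    using that assms(3) by (cases a) (auto simp: spencer_gens_def)
qed (use assms in \<open>auto simp: spencer_chains_def\<close>)

lemma chain_map_simps [simp]:
  "chain_map \<phi> \<psi> 0 = 0"
  "chain_map \<phi> \<psi> (x - y) = chain_map \<phi> \<psi> x - chain_map \<phi> \<psi> y"
  "chain_map \<phi> \<psi> (x + y) = chain_map \<phi> \<psi> x + chain_map \<phi> \<psi> y"
  "chain_map \<phi> \<psi> (- x) = - chain_map \<phi> \<psi> x"
  "chain_map \<phi> \<psi> (frag_cmul k x) = frag_cmul k (chain_map \<phi> \<psi> x)"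
  "chain_map \<phi> \<psi> (frag_of (P, xs)) = frag_of (\<phi> P, map \<psi> xs)"
  by (simp_all add: chain_map_def frag_extend_diff frag_extend_add frag_extend_minus
      frag_extend_cmul)

lemma chain_map_sum: "finite I \<Longrightarrow> chain_map \<phi> \<psi> (\<Sum>i\<in>I. g i) = (\<Sum>i\<in>I. chain_map \<phi> \<psi> (g i))"
  by (simp add: chain_map_def frag_extend_sum o_def)

locale spencer_data = ring B for B (structure) +
  fixes R L :: "'a set"
  assumes R_sub: "R \<subseteq> carrier B"
    and L_sub: "L \<subseteq> carrier B"
    and L_add: "x \<in> L \<Longrightarrow> y \<in> L \<Longrightarrow> x \<oplus> y \<in> L"
    and L_mult: "a \<in> R \<Longrightarrow> x \<in> L \<Longrightarrow> a \<otimes> x \<in> L"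
begin

lemma spencer_rels_subset: "spencer_rels B R L r \<subseteq> spencer_chains B L r"
proof -
  have upd: "set (xs[i := x]) \<subseteq> L" if "set xs \<subseteq> L" "x \<in> L" for xs i x
    using that set_update_subset_insert[of xs i x] by blast
  show ?thesis
    unfolding spencer_rels_def
  proof (intro Un_least subsetI; clarify)
    fix P Q xs
    assume "(P, xs) \<in> spencer_gens B L r" "Q \<in> carrier B"
    then show "frag_of (P \<oplus> Q, xs) - frag_of (P, xs) - frag_of (Q, xs) \<in> spencer_chains B L r"
      by (intro spencer_chains_diff) (auto simp: spencer_gens_def)
  next
    fix P xs i x y
    assume "(P, xs) \<in> spencer_gens B L r" "i < r" "x \<in> L" "y \<in> L"
    then show "frag_of (P, xs[i := x \<oplus> y]) - frag_of (P, xs[i := x]) - frag_of (P, xs[i := y])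
        \<in> spencer_chains B L r"
      using upd L_add by (intro spencer_chains_diff) (auto simp: spencer_gens_def)
  next
    fix P a xs i
    assume "(P, xs) \<in> spencer_gens B L r" "i < r" "a \<in> R"
    moreover from this have "a \<otimes> xs ! i \<in> L"
      by (intro L_mult) (auto simp: spencer_gens_def)
    ultimately show "frag_of (P \<otimes> a, xs) - frag_of (P, xs[i := a \<otimes> xs ! i]) \<in> spencer_chains B L r"
      using upd R_sub by (intro spencer_chains_diff) (auto simp: spencer_gens_def)
  qed simp
qed

lemma rel_subgroup:
  "subgroup (spencer_rel_group B R L r) (free_Abelian_group (spencer_gens B L r))"
  unfolding spencer_rel_group_def
  using spencer_rels_subset
  by (intro group.generate_is_subgroup) (simp_all add: carrier_free_chains del: carrier_free_Abelian_group_iff)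

lemma rel_chain: "x \<in> spencer_rel_group B R L r \<Longrightarrow> x \<in> spencer_chains B L r"
  using subgroup.subset[OF rel_subgroup, of r] unfolding carrier_free_chains by blast

lemma rel_zero [simp]: "0 \<in> spencer_rel_group B R L r"
  using subgroup.one_closed[OF rel_subgroup, of r] by simp

lemma rel_add:
  "x \<in> spencer_rel_group B R L r \<Longrightarrow> y \<in> spencer_rel_group B R L r \<Longrightarrow> x + y \<in> spencer_rel_group B R L r"
  using subgroup.m_closed[OF rel_subgroup, of x r y] by simp

lemma rel_minus: "x \<in> spencer_rel_group B R L r \<Longrightarrow> - x \<in> spencer_rel_group B R L r"
  using subgroup.m_inv_closed[OF rel_subgroup, of x r] rel_chain[of x r]
  by (simp add: spencer_chains_def)

lemma rel_diff:
  "x \<in> spencer_rel_group B R L r \<Longrightarrow> y \<in> spencer_rel_group B R L r \<Longrightarrow> x - y \<in> spencer_rel_group B R L r"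
  using rel_add[of x r "- y"] rel_minus[of y r] by simp

lemma rel_gen: "x \<in> spencer_rels B R L r \<Longrightarrow> x \<in> spencer_rel_group B R L r"
  unfolding spencer_rel_group_def by (rule generate.incl)

lemma rel_induct [consumes 1, case_names zero rel diff]:
  assumes "z \<in> spencer_rel_group B R L r" "Q 0"
    and gen: "\<And>x. x \<in> spencer_rels B R L r \<Longrightarrow> Q x"
    and diff: "\<And>x y. Q x \<Longrightarrow> Q y \<Longrightarrow> Q (x - y)"
  shows "Q z"
  using assms(1) unfolding spencer_rel_group_def
proof (induction rule: generate.induct)
  case (inv h)
  then have "inv\<^bsub>free_Abelian_group (spencer_gens B L r)\<^esub> h = 0 - h"
    using spencer_rels_subset[of r] by (subst inv_free_Abelian_group) (auto simp: spencer_chains_def)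
  with diff[OF \<open>Q 0\<close> gen[OF inv]] show ?case by simp
next
  case (eng x y)
  then have "Q (x - (0 - y))"
    by (intro diff \<open>Q 0\<close>)
  then show ?case by simp
qed (use assms in auto)

lemma rel_coset_iff:
  "y \<in> spencer_rel_group B R L r #>\<^bsub>free_Abelian_group (spencer_gens B L r)\<^esub> x
    \<longleftrightarrow> y - x \<in> spencer_rel_group B R L r"
  unfolding r_coset_def by (auto simp: image_iff) (metis diff_add_cancel)

lemma rel_coset_eq_iff:
  "spencer_rel_group B R L r #>\<^bsub>free_Abelian_group (spencer_gens B L r)\<^esub> x =
   spencer_rel_group B R L r #>\<^bsub>free_Abelian_group (spencer_gens B L r)\<^esub> y
    \<longleftrightarrow> x - y \<in> spencer_rel_group B R L r" (is "?l = ?r \<longleftrightarrow> _")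
proof
  assume "?l = ?r"
  moreover have "x \<in> ?l" by (simp add: rel_coset_iff)
  ultimately show "x - y \<in> spencer_rel_group B R L r" by (simp add: rel_coset_iff)
next
  assume xy: "x - y \<in> spencer_rel_group B R L r"
  show "?l = ?r"
  proof (intro Set.set_eqI)
    fix z
    have "z - x = (z - y) - (x - y)" "z - y = (z - x) + (x - y)" by simp_all
    then show "z \<in> ?l \<longleftrightarrow> z \<in> ?r"
      unfolding rel_coset_iff using rel_add rel_diff xy by metis
  qed
qed

lemma rel_coset_zero:
  "spencer_rel_group B R L r #>\<^bsub>free_Abelian_group (spencer_gens B L r)\<^esub> 0 = spencer_rel_group B R L r"
  by (auto simp: rel_coset_iff)

lemma carrier_spencer_term:
  "carrier (spencer_term B R L r) =
    (\<lambda>x. spencer_rel_group B R L r #>\<^bsub>free_Abelian_group (spencer_gens B L r)\<^esub> x) ` spencer_chains B L r"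
  unfolding spencer_term_def carrier_FactGroup carrier_free_chains ..

lemma one_spencer_term: "\<one>\<^bsub>spencer_term B R L r\<^esub> = spencer_rel_group B R L r"
  by (simp add: spencer_term_def FactGroup_def)

lemma spencer_diff_iff:
  "y \<in> spencer_diff B R L r C \<longleftrightarrow>
    (\<exists>z\<in>C. y - chain_diff B z \<in> spencer_rel_group B R L (r - 1))"
  by (simp add: spencer_diff_def rel_coset_iff)

lemma spencer_diff_coset:
  assumes dM: "\<And>m. m \<in> spencer_rel_group B R L r \<Longrightarrow> chain_diff B m \<in> spencer_rel_group B R L (r - 1)"
  shows "spencer_diff B R L r
      (spencer_rel_group B R L r #>\<^bsub>free_Abelian_group (spencer_gens B L r)\<^esub> x) =
    spencer_rel_group B R L (r - 1) #>\<^bsub>free_Abelian_group (spencer_gens B L (r - 1))\<^esub> chain_diff B x"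
    (is "spencer_diff B R L r ?C = ?K")
proof -
  have "spencer_rel_group B R L (r - 1) #>\<^bsub>free_Abelian_group (spencer_gens B L (r - 1))\<^esub> chain_diff B z
     = spencer_rel_group B R L (r - 1) #>\<^bsub>free_Abelian_group (spencer_gens B L (r - 1))\<^esub> chain_diff B x"
    if "z - x \<in> spencer_rel_group B R L r" for z
    unfolding rel_coset_eq_iff frag_extend_diff[symmetric] by (rule dM[OF that])
  then have "spencer_diff B R L r ?C = (\<Union>z\<in>?C. ?K)"
    unfolding spencer_diff_def by (intro SUP_cong refl) (simp only: rel_coset_iff)
  moreover have "x \<in> ?C" by (simp add: rel_coset_iff)
  then have "?C \<noteq> {}" by blast
  ultimately show ?thesis by (simp only: UN_constant if_False)
qed

text \<open>
  The cosets are traded for representatives here. The first two conjuncts on the right - the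
  differential into degree \<open>-r\<close> respects the relations, maps chains to chains and composes to zero -
  come for free from left to right: the union of cosets that \<open>spencer_diff\<close> assigns to a coset lies in
  the kernel, hence in the carrier of the quotient, and so it is a single coset.
\<close>

lemma spencer_exact_iff:
  assumes "r \<ge> 1"
    and dM: "\<And>m. m \<in> spencer_rel_group B R L r \<Longrightarrow> chain_diff B m \<in> spencer_rel_group B R L (r - 1)"
  shows "spencer_exact B R L r \<longleftrightarrow>
    (\<forall>m\<in>spencer_rel_group B R L (r + 1). chain_diff B m \<in> spencer_rel_group B R L r) \<and>
    (\<forall>v\<in>spencer_chains B L (r + 1). chain_diff B v \<in> spencer_chains B L r \<and>
        chain_diff B (chain_diff B v) \<in> spencer_rel_group B R L (r - 1)) \<and>
    (\<forall>z\<in>spencer_chains B L r. chain_diff B z \<in> spencer_rel_group B R L (r - 1) \<longrightarrow>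
        (\<exists>v\<in>spencer_chains B L (r + 1). z - chain_diff B v \<in> spencer_rel_group B R L r))"
    (is "_ \<longleftrightarrow> ?dM \<and> ?dd \<and> ?ex")
proof -
  let ?cos = "\<lambda>r x. spencer_rel_group B R L r #>\<^bsub>free_Abelian_group (spencer_gens B L r)\<^esub> x"
  let ?ker = "kernel (spencer_term B R L r) (spencer_term B R L (r - 1)) (spencer_diff B R L r)"
  let ?im = "spencer_diff B R L (r + 1) ` carrier (spencer_term B R L (r + 1))"
  have ker: "C \<in> ?ker \<longleftrightarrow>
      (\<exists>z\<in>spencer_chains B L r. C = ?cos r z \<and> chain_diff B z \<in> spencer_rel_group B R L (r - 1))" for C
  proof -
    have "spencer_diff B R L r (?cos r z) = spencer_rel_group B R L (r - 1)
        \<longleftrightarrow> chain_diff B z \<in> spencer_rel_group B R L (r - 1)" for z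
      using rel_coset_eq_iff[of "r - 1" "chain_diff B z" 0] spencer_diff_coset[OF dM, of z]
      unfolding rel_coset_zero by simp
    then show ?thesis
      by (auto simp: kernel_def carrier_spencer_term one_spencer_term)
  qed
  show ?thesis
  proof
    assume ex: "spencer_exact B R L r"
    then have eq: "?ker = ?im" by (simp add: spencer_exact_def)
    have single: "\<exists>z\<in>spencer_chains B L r. spencer_diff B R L (r + 1) (?cos (r + 1) v) = ?cos r z \<and>
        chain_diff B z \<in> spencer_rel_group B R L (r - 1)"
      if "v \<in> spencer_chains B L (r + 1)" for v
    proof -
      have "spencer_diff B R L (r + 1) (?cos (r + 1) v) \<in> ?ker"
        unfolding eq carrier_spencer_term using that by blast
      then show ?thesis unfolding ker by blast
    qed
    have dd: ?dd
    proof (intro ballI)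
      fix v assume v: "v \<in> spencer_chains B L (r + 1)"
      obtain z where z: "z \<in> spencer_chains B L r"
        "spencer_diff B R L (r + 1) (?cos (r + 1) v) = ?cos r z"
        "chain_diff B z \<in> spencer_rel_group B R L (r - 1)"
        using single[OF v] by blast
      have "chain_diff B v \<in> spencer_diff B R L (r + 1) (?cos (r + 1) v)"
        unfolding spencer_diff_iff by (rule bexI[of _ v]) (simp_all add: rel_coset_iff)
      then have *: "chain_diff B v - z \<in> spencer_rel_group B R L r"
        unfolding z rel_coset_iff .
      have "chain_diff B v = (chain_diff B v - z) + z" by simp
      then have "chain_diff B v \<in> spencer_chains B L r"
        using rel_chain[OF *] z(1) spencer_chains_add by metis
      moreover have "chain_diff B (chain_diff B v) = chain_diff B (chain_diff B v - z) + chain_diff B z"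
        by (simp add: frag_extend_diff)
      then have "chain_diff B (chain_diff B v) \<in> spencer_rel_group B R L (r - 1)"
        using rel_add dM[OF *] z(3) by metis
      ultimately show "chain_diff B v \<in> spencer_chains B L r \<and>
        chain_diff B (chain_diff B v) \<in> spencer_rel_group B R L (r - 1)" ..
    qed
    have m: ?dM
    proof
      fix m assume m: "m \<in> spencer_rel_group B R L (r + 1)"
      obtain z where z: "z \<in> spencer_chains B L r"
        "spencer_diff B R L (r + 1) (?cos (r + 1) 0) = ?cos r z"
        using single[of 0] by auto
      have "chain_diff B m \<in> ?cos r z"
        unfolding z(2)[symmetric] spencer_diff_iff rel_coset_zero
        by (rule bexI[OF _ m]) simp
      moreover have "0 \<in> ?cos r z"
        unfolding z(2)[symmetric] spencer_diff_iff rel_coset_zero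
        by (rule bexI[OF _ rel_zero]) simp
      ultimately have "(chain_diff B m - z) - (0 - z) \<in> spencer_rel_group B R L r"
        unfolding rel_coset_iff by (rule rel_diff)
      then show "chain_diff B m \<in> spencer_rel_group B R L r" by simp
    qed
    have ?ex
    proof (intro ballI impI)
      fix z assume "z \<in> spencer_chains B L r" "chain_diff B z \<in> spencer_rel_group B R L (r - 1)"
      then have "?cos r z \<in> ?im" unfolding eq[symmetric] ker by blast
      then obtain v where v: "v \<in> spencer_chains B L (r + 1)"
        "?cos r z = spencer_diff B R L (r + 1) (?cos (r + 1) v)"
        unfolding carrier_spencer_term by blast
      then have "?cos r z = ?cos r (chain_diff B v)"
        using spencer_diff_coset[of "r + 1" v] m by simp
      then show "\<exists>v\<in>spencer_chains B L (r + 1). z - chain_diff B v \<in> spencer_rel_group B R L r"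
        using v(1) unfolding rel_coset_eq_iff by blast
    qed
    with m dd show "?dM \<and> ?dd \<and> ?ex" by blast
  next
    assume *: "?dM \<and> ?dd \<and> ?ex"
    have cos: "spencer_diff B R L (r + 1) (?cos (r + 1) v) = ?cos r (chain_diff B v)" for v
      using spencer_diff_coset[of "r + 1" v] * by simp
    have "?ker \<subseteq> ?im"
    proof
      fix C assume "C \<in> ?ker"
      then obtain z where z: "z \<in> spencer_chains B L r" "C = ?cos r z"
        "chain_diff B z \<in> spencer_rel_group B R L (r - 1)" unfolding ker by blast
      then obtain v where v: "v \<in> spencer_chains B L (r + 1)"
        "z - chain_diff B v \<in> spencer_rel_group B R L r" using * by blast
      have "C = spencer_diff B R L (r + 1) (?cos (r + 1) v)"
        unfolding cos z(2) rel_coset_eq_iff by (rule v(2))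
      then show "C \<in> ?im"
        unfolding carrier_spencer_term using v(1) by (intro image_eqI[OF _ imageI])
    qed
    moreover have "?im \<subseteq> ?ker"
    proof (unfold carrier_spencer_term image_image, rule image_subsetI)
      fix v assume "v \<in> spencer_chains B L (r + 1)"
      with * show "spencer_diff B R L (r + 1) (?cos (r + 1) v) \<in> ?ker"
        unfolding cos ker by (intro bexI[of _ "chain_diff B v"]) simp_all
    qed
    ultimately show "spencer_exact B R L r" unfolding spencer_exact_def by (rule equalityI)
  qed
qed

end


section \<open>Maps between Spencer complexes\<close>

lemma chain_map_chains:
  assumes "z \<in> spencer_chains B L r"
    and "\<And>P. P \<in> carrier B \<Longrightarrow> \<phi> P \<in> carrier B'" and "\<And>x. x \<in> L \<Longrightarrow> \<psi> x \<in> L'"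
  shows "chain_map \<phi> \<psi> z \<in> spencer_chains B' L' r"
  using assms(1)
proof (induction rule: spencer_chains_induct)
  case (gen P xs)
  then show ?case using assms(2,3) by (auto simp: spencer_gens_def)
qed (simp_all add: spencer_chains_diff)

text \<open>
  The relations see only the additive structure and the action of the base ring. So the lemma covers
  multiplication by a central element and the division by \<open>s\<close> as well as ring homomorphisms.
\<close>

lemma chain_map_rel_group:
  assumes "spencer_data B R L" "spencer_data B' R' L'"
    and \<phi>: "\<And>P. P \<in> carrier B \<Longrightarrow> \<phi> P \<in> carrier B'"
    and \<phi>_add: "\<And>P Q. P \<in> carrier B \<Longrightarrow> Q \<in> carrier B \<Longrightarrow> \<phi> (P \<oplus>\<^bsub>B\<^esub> Q) = \<phi> P \<oplus>\<^bsub>B'\<^esub> \<phi> Q"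
    and \<phi>_mult: "\<And>P a. P \<in> carrier B \<Longrightarrow> a \<in> R \<Longrightarrow> \<phi> (P \<otimes>\<^bsub>B\<^esub> a) = \<phi> P \<otimes>\<^bsub>B'\<^esub> \<gamma> a"
    and \<gamma>: "\<And>a. a \<in> R \<Longrightarrow> \<gamma> a \<in> R'"
    and \<psi>: "\<And>x. x \<in> L \<Longrightarrow> \<psi> x \<in> L'"
    and \<psi>_add: "\<And>x y. x \<in> L \<Longrightarrow> y \<in> L \<Longrightarrow> \<psi> (x \<oplus>\<^bsub>B\<^esub> y) = \<psi> x \<oplus>\<^bsub>B'\<^esub> \<psi> y"
    and \<psi>_mult: "\<And>a x. a \<in> R \<Longrightarrow> x \<in> L \<Longrightarrow> \<psi> (a \<otimes>\<^bsub>B\<^esub> x) = \<gamma> a \<otimes>\<^bsub>B'\<^esub> \<psi> x"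
    and "z \<in> spencer_rel_group B R L r"
  shows "chain_map \<phi> \<psi> z \<in> spencer_rel_group B' R' L' r"
proof -
  interpret B: spencer_data B R L by fact
  interpret B': spencer_data B' R' L' by fact
  have gens: "(\<phi> P, map \<psi> xs) \<in> spencer_gens B' L' r" if "(P, xs) \<in> spencer_gens B L r" for P xs
    using that \<phi> \<psi> by (auto simp: spencer_gens_def)
  show ?thesis
    using \<open>z \<in> spencer_rel_group B R L r\<close>
  proof (induction rule: B.rel_induct)
    case (rel x)
    have "chain_map \<phi> \<psi> x \<in> spencer_rels B' R' L' r"
      using rel[unfolded spencer_rels_def]
    proof (elim UnE CollectE exE conjE)
      fix P Q xs
      assume x: "x = frag_of (P \<oplus>\<^bsub>B\<^esub> Q, xs) - frag_of (P, xs) - frag_of (Q, xs)"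
        and P: "(P, xs) \<in> spencer_gens B L r" "Q \<in> carrier B"
      have "chain_map \<phi> \<psi> x = frag_of (\<phi> P \<oplus>\<^bsub>B'\<^esub> \<phi> Q, map \<psi> xs) - frag_of (\<phi> P, map \<psi> xs)
          - frag_of (\<phi> Q, map \<psi> xs)"
        using P by (simp add: x \<phi>_add spencer_gens_def)
      then show "chain_map \<phi> \<psi> x \<in> spencer_rels B' R' L' r"
        unfolding spencer_rels_def using gens[OF P(1)] \<phi>[OF P(2)] by blast
    next
      fix P xs i u v
      assume x: "x = frag_of (P, xs[i := u \<oplus>\<^bsub>B\<^esub> v]) - frag_of (P, xs[i := u]) - frag_of (P, xs[i := v])"
        and P: "(P, xs) \<in> spencer_gens B L r" "i < r" "u \<in> L" "v \<in> L"
      have "chain_map \<phi> \<psi> x = frag_of (\<phi> P, (map \<psi> xs)[i := \<psi> u \<oplus>\<^bsub>B'\<^esub> \<psi> v])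
          - frag_of (\<phi> P, (map \<psi> xs)[i := \<psi> u]) - frag_of (\<phi> P, (map \<psi> xs)[i := \<psi> v])"
        using P by (simp add: x \<psi>_add map_update)
      then show "chain_map \<phi> \<psi> x \<in> spencer_rels B' R' L' r"
        unfolding spencer_rels_def using gens[OF P(1)] P(2) \<psi>[OF P(3)] \<psi>[OF P(4)] by blast
    next
      fix P a xs i
      assume x: "x = frag_of (P \<otimes>\<^bsub>B\<^esub> a, xs) - frag_of (P, xs[i := a \<otimes>\<^bsub>B\<^esub> xs ! i])"
        and P: "(P, xs) \<in> spencer_gens B L r" "i < r" "a \<in> R"
      have "xs ! i \<in> L" "P \<in> carrier B" "i < length xs"
        using P by (auto simp: spencer_gens_def)
      then have "chain_map \<phi> \<psi> x = frag_of (\<phi> P \<otimes>\<^bsub>B'\<^esub> \<gamma> a, map \<psi> xs)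
          - frag_of (\<phi> P, (map \<psi> xs)[i := \<gamma> a \<otimes>\<^bsub>B'\<^esub> (map \<psi> xs ! i)])"
        using P by (simp add: x \<phi>_mult \<psi>_mult map_update)
      then show "chain_map \<phi> \<psi> x \<in> spencer_rels B' R' L' r"
        unfolding spencer_rels_def using gens[OF P(1)] P(2) \<gamma>[OF P(3)] by blast
    next
      fix P xs i j
      assume x: "x = frag_of (P, xs)"
        and P: "(P, xs) \<in> spencer_gens B L r" "i < j" "j < r" "xs ! i = xs ! j"
      have "map \<psi> xs ! i = map \<psi> xs ! j"
        using P by (auto simp: spencer_gens_def)
      then show "chain_map \<phi> \<psi> x \<in> spencer_rels B' R' L' r"
        unfolding spencer_rels_def using gens[OF P(1)] P(2,3) x by auto
    qed
    then show ?case by (rule B'.rel_gen)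
  qed (simp_all add: B'.rel_diff)
qed



section \<open>The Spencer complex in degree zero\<close>

lemma spencer_diff_gen_Cons1:
  "spencer_diff_gen B (P, [x]) = frag_of (P \<otimes>\<^bsub>B\<^esub> x, [])"
  by (simp add: spencer_diff_gen_def nths_Cons)

context spencer_data
begin

lemma frag_of_add_rel:
  assumes "P \<in> carrier B" "Q \<in> carrier B" "length xs = r" "set xs \<subseteq> L"
  shows "frag_of (P \<oplus> Q, xs) - frag_of (P, xs) - frag_of (Q, xs) \<in> spencer_rel_group B R L r"
proof (rule rel_gen)
  have "(P, xs) \<in> spencer_gens B L r" using assms by (simp add: spencer_gens_def)
  then show "frag_of (P \<oplus> Q, xs) - frag_of (P, xs) - frag_of (Q, xs) \<in> spencer_rels B R L r"
    unfolding spencer_rels_def using assms(2) by blast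
qed

lemma chain_diff_rel_1:
  assumes "m \<in> spencer_rel_group B R L 1"
  shows "chain_diff B m \<in> spencer_rel_group B R L 0"
  using assms
proof (induction rule: rel_induct)
  case (rel z)
  have add: "frag_of (P \<oplus> Q, []) - frag_of (P, []) - frag_of (Q, []) \<in> spencer_rel_group B R L 0"
    if "P \<in> carrier B" "Q \<in> carrier B" for P Q
    using that by (intro frag_of_add_rel) simp_all
  show ?case
    using rel unfolding spencer_rels_def
  proof (elim UnE CollectE exE conjE)
    fix P Q xs
    assume z: "z = frag_of (P \<oplus> Q, xs) - frag_of (P, xs) - frag_of (Q, xs)"
      and P: "(P, xs) \<in> spencer_gens B L 1" "Q \<in> carrier B"
    then obtain x where x: "xs = [x]" "x \<in> L" "P \<in> carrier B"
      by (auto simp: spencer_gens_def length_Suc_conv)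
    with P L_sub have "x \<in> carrier B" by blast
    with x P have "chain_diff B z = frag_of (P \<otimes> x \<oplus> Q \<otimes> x, []) - frag_of (P \<otimes> x, []) - frag_of (Q \<otimes> x, [])"
      by (simp add: z frag_extend_diff spencer_diff_gen_Cons1 l_distr)
    then show "chain_diff B z \<in> spencer_rel_group B R L 0"
      using add[of "P \<otimes> x" "Q \<otimes> x"] x P \<open>x \<in> carrier B\<close> by simp
  next
    fix P xs i u v
    assume z: "z = frag_of (P, xs[i := u \<oplus> v]) - frag_of (P, xs[i := u]) - frag_of (P, xs[i := v])"
      and P: "(P, xs) \<in> spencer_gens B L 1" "i < 1" "u \<in> L" "v \<in> L"
    then obtain x where x: "xs = [x]" "x \<in> L" "P \<in> carrier B"
      by (auto simp: spencer_gens_def length_Suc_conv)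
    have uv: "u \<in> carrier B" "v \<in> carrier B" using P L_sub by auto
    with x P have "chain_diff B z = frag_of (P \<otimes> u \<oplus> P \<otimes> v, []) - frag_of (P \<otimes> u, []) - frag_of (P \<otimes> v, [])"
      by (simp add: z frag_extend_diff spencer_diff_gen_Cons1 r_distr)
    then show "chain_diff B z \<in> spencer_rel_group B R L 0"
      using add[of "P \<otimes> u" "P \<otimes> v"] x uv by simp
  next
    fix P a xs i
    assume z: "z = frag_of (P \<otimes> a, xs) - frag_of (P, xs[i := a \<otimes> xs ! i])"
      and P: "(P, xs) \<in> spencer_gens B L 1" "i < 1" "a \<in> R"
    then obtain x where x: "xs = [x]" "x \<in> L" "P \<in> carrier B"
      by (auto simp: spencer_gens_def length_Suc_conv)
    have "x \<in> carrier B" "a \<in> carrier B" using x P L_sub R_sub by auto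
    with x P have "chain_diff B z = 0"
      by (simp add: z frag_extend_diff spencer_diff_gen_Cons1 m_assoc)
    then show "chain_diff B z \<in> spencer_rel_group B R L 0" by simp
  qed simp
qed (simp_all add: frag_extend_diff rel_diff)

lemma chain_diff_chains_1:
  assumes "z \<in> spencer_chains B L 1"
  shows "chain_diff B z \<in> spencer_chains B L 0"
  using assms
proof (induction rule: spencer_chains_induct)
  case (gen P xs)
  then obtain x where "xs = [x]" "x \<in> L"
    by (auto simp: length_Suc_conv)
  with gen show ?case
    using L_sub by (auto simp: spencer_diff_gen_Cons1 spencer_gens_def)
qed (simp_all add: frag_extend_diff spencer_chains_diff)

lemma frag_of_zero_rel:
  assumes "length xs = r" "set xs \<subseteq> L"
  shows "frag_of (\<zero>, xs) \<in> spencer_rel_group B R L r"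
  using rel_minus[OF frag_of_add_rel[of \<zero> \<zero> xs r]] assms by simp

lemma frag_of_diff_rel:
  assumes "P \<in> carrier B" "Q \<in> carrier B" "length xs = r" "set xs \<subseteq> L"
  shows "frag_of (P, xs) - frag_of (Q, xs) - frag_of (P \<ominus> Q, xs) \<in> spencer_rel_group B R L r"
proof -
  have "P \<ominus> Q \<oplus> Q = P"
    using assms by (simp add: minus_eq a_assoc l_neg)
  then show ?thesis
    using frag_of_add_rel[of "P \<ominus> Q" Q xs r] assms by (simp add: algebra_simps)
qed

text \<open>
  In degree zero the only relations are additivity in \<open>P\<close>, so \<open>P \<mapsto> [P \<otimes> ()]\<close> identifies the ring with the
  degree zero term. This lemma is surjectivity of that map, and \<open>frag_of_rel_0_iff\<close> is injectivity.
\<close>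

lemma chains_0_normal_form:
  assumes "z \<in> spencer_chains B L 0"
  shows "\<exists>P\<in>carrier B. z - frag_of (P, []) \<in> spencer_rel_group B R L 0"
  using assms
proof (induction rule: spencer_chains_induct)
  case zero
  then show ?case
    using rel_minus[OF frag_of_zero_rel[of "[]" 0]] by (intro bexI[of _ \<zero>]) simp_all
next
  case (gen P xs)
  then show ?case by (intro bexI[of _ P]) simp_all
next
  case (diff x y)
  then obtain P Q where PQ: "P \<in> carrier B" "x - frag_of (P, []) \<in> spencer_rel_group B R L 0"
    "Q \<in> carrier B" "y - frag_of (Q, []) \<in> spencer_rel_group B R L 0" by blast
  have "x - y - frag_of (P \<ominus> Q, []) = (x - frag_of (P, [])) - (y - frag_of (Q, []))
      + (frag_of (P, []) - frag_of (Q, []) - frag_of (P \<ominus> Q, []))"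
    by simp
  also have "\<dots> \<in> spencer_rel_group B R L 0"
    by (rule rel_add[OF rel_diff[OF PQ(2,4)] frag_of_diff_rel[OF PQ(1,3)]]) simp_all
  finally have "x - y - frag_of (P \<ominus> Q, []) \<in> spencer_rel_group B R L 0" .
  then show ?case using PQ by (intro bexI[of _ "P \<ominus> Q"]) auto
qed

text \<open>
  The additive map from the free group to the ring with \<open>P \<otimes> () \<mapsto> P\<close> vanishes on all relations of degree
  zero, since the relations that mention a list entry are absent there.
\<close>

lemma frag_of_rel_0_iff:
  assumes "P \<in> carrier B"
  shows "frag_of (P, []) \<in> spencer_rel_group B R L 0 \<longleftrightarrow> P = \<zero>"
proof
  have "fst ` spencer_gens B L 0 \<subseteq> carrier (add_monoid B)"
    by (auto simp: spencer_gens_def)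
  then obtain h where hom: "h \<in> hom (free_Abelian_group (spencer_gens B L 0)) (add_monoid B)"
    and h: "\<And>g. g \<in> spencer_gens B L 0 \<Longrightarrow> h (frag_of g) = fst g"
    using comm_group.free_Abelian_group_universal[OF a_comm_group] by metis
  interpret h: group_hom "free_Abelian_group (spencer_gens B L 0)" "add_monoid B" h
    using hom a_group by (intro group_hom.intro) (simp_all add: group_hom_axioms_def)
  have h_add: "h (x + y) = h x \<oplus> h y"
    if "x \<in> spencer_chains B L 0" "y \<in> spencer_chains B L 0" for x y
    using h.hom_mult[of x y] that by (simp add: spencer_chains_def)
  have h_diff: "h (x - y) \<oplus> h y = h x"
    if "x \<in> spencer_chains B L 0" "y \<in> spencer_chains B L 0" for x y
    using h_add[OF spencer_chains_diff[OF that] that(2)] by simp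
  have h_closed: "h x \<in> carrier B" if "x \<in> spencer_chains B L 0" for x
    using h.hom_closed[of x] that by (simp add: spencer_chains_def)
  have kill: "z \<in> spencer_chains B L 0 \<and> h z = \<zero>" if "z \<in> spencer_rel_group B R L 0" for z
    using that
  proof (induction rule: rel_induct)
    case zero
    show ?case using h.hom_one by simp
  next
    case (rel x)
    then obtain P Q xs where P: "x = frag_of (P \<oplus> Q, xs) - frag_of (P, xs) - frag_of (Q, xs)"
      "P \<in> carrier B" "Q \<in> carrier B" "xs = []"
      by (auto simp: spencer_rels_def spencer_gens_def)
    then have gens: "(P \<oplus> Q, xs) \<in> spencer_gens B L 0" "(P, xs) \<in> spencer_gens B L 0"
      "(Q, xs) \<in> spencer_gens B L 0" by (auto simp: spencer_gens_def)
    have x: "x \<in> spencer_chains B L 0"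
      using rel spencer_rels_subset by blast
    have "x + (frag_of (P, xs) + frag_of (Q, xs)) = frag_of (P \<oplus> Q, xs)"
      by (simp add: P)
    then have "h x \<oplus> (P \<oplus> Q) = P \<oplus> Q"
      using h_add[of x "frag_of (P, xs) + frag_of (Q, xs)"] h_add[of "frag_of (P, xs)" "frag_of (Q, xs)"]
        gens h x by (simp add: spencer_chains_add)
    then have "h x = \<zero>"
      using P h_closed[OF x] add.r_cancel_one[of "P \<oplus> Q" "h x"] by simp
    with x show ?case by simp
  next
    case (diff x y)
    then show ?case using h_diff[of x y] h_closed[of "x - y"] spencer_chains_diff[of x B L 0 y] by simp
  qed
  assume "frag_of (P, []) \<in> spencer_rel_group B R L 0"
  from kill[OF this] show "P = \<zero>"
    using assms h[of "(P, [])"] by (simp add: spencer_gens_def)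
qed (use frag_of_zero_rel[of "[]" 0] in simp)

text \<open>
  Under the identification of the degree zero term with the ring, the left ideal generated by \<open>L\<close> is the
  image of the last differential \<open>P \<otimes> x \<mapsto> P x\<close>; so the cohomology in degree zero is the ring modulo that
  left ideal.
\<close>

lemma left_ideal_gen_iff:
  assumes "P \<in> carrier B"
  shows "P \<in> left_ideal_gen B L \<longleftrightarrow>
    (\<exists>u\<in>spencer_chains B L 1. frag_of (P, []) - chain_diff B u \<in> spencer_rel_group B R L 0)"
proof
  assume "P \<in> left_ideal_gen B L"
  then have "P \<in> carrier B \<and>
    (\<exists>u\<in>spencer_chains B L 1. frag_of (P, []) - chain_diff B u \<in> spencer_rel_group B R L 0)"
    unfolding left_ideal_gen_def
  proof (induction rule: generate.induct)
    case one
    show ?case using frag_of_zero_rel[of "[]" 0] by (auto intro!: bexI[of _ 0])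
  next
    case (incl h)
    then obtain Q x where "h = Q \<otimes> x" "Q \<in> carrier B" "x \<in> L" by blast
    then show ?case
      using L_sub by (auto intro!: bexI[of _ "frag_of (Q, [x])"] simp: spencer_diff_gen_Cons1 spencer_gens_def)
  next
    case (inv h)
    then obtain Q x where h: "h = Q \<otimes> x" "Q \<in> carrier B" "x \<in> L" by blast
    with L_sub have x: "x \<in> carrier B" by blast
    have "inv\<^bsub>add_monoid B\<^esub> h = \<ominus> Q \<otimes> x"
      using h x by (simp add: a_inv_def[symmetric] l_minus)
    then show ?case
      using h x by (auto intro!: bexI[of _ "frag_of (\<ominus> Q, [x])"] simp: spencer_diff_gen_Cons1 spencer_gens_def)
  next
    case (eng h1 h2)
    then obtain u1 u2 where u: "u1 \<in> spencer_chains B L 1" "u2 \<in> spencer_chains B L 1"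
      "frag_of (h1, []) - chain_diff B u1 \<in> spencer_rel_group B R L 0"
      "frag_of (h2, []) - chain_diff B u2 \<in> spencer_rel_group B R L 0" by blast
    have "frag_of (h1 \<oplus> h2, []) - chain_diff B (u1 + u2) =
        (frag_of (h1 \<oplus> h2, []) - frag_of (h1, []) - frag_of (h2, []))
        + ((frag_of (h1, []) - chain_diff B u1) + (frag_of (h2, []) - chain_diff B u2))"
      by (simp add: frag_extend_add)
    also have "\<dots> \<in> spencer_rel_group B R L 0"
      using eng by (intro rel_add u frag_of_add_rel) auto
    finally show ?case
      using eng u spencer_chains_add[OF u(1,2)] by (intro conjI bexI[of _ "u1 + u2"]) auto
  qed
  then show "\<exists>u\<in>spencer_chains B L 1. frag_of (P, []) - chain_diff B u \<in> spencer_rel_group B R L 0"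
    by blast
next
  have gen_sub: "{P \<otimes> x | P x. P \<in> carrier B \<and> x \<in> L} \<subseteq> carrier (add_monoid B)"
    using L_sub by auto
  have sub: "subgroup (left_ideal_gen B L) (add_monoid B)"
    unfolding left_ideal_gen_def by (rule group.generate_is_subgroup[OF a_group gen_sub])
  have ideal_diff: "x \<ominus> y \<in> left_ideal_gen B L" if "x \<in> left_ideal_gen B L" "y \<in> left_ideal_gen B L" for x y
    using that subgroup.m_closed[OF sub] subgroup.m_inv_closed[OF sub]
    by (simp add: a_minus_def a_inv_def)
  have *: "\<exists>Q\<in>left_ideal_gen B L. Q \<in> carrier B \<and> chain_diff B u - frag_of (Q, []) \<in> spencer_rel_group B R L 0"
    if "u \<in> spencer_chains B L 1" for u
    using that
  proof (induction rule: spencer_chains_induct)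
    case zero
    show ?case
      using subgroup.one_closed[OF sub] rel_minus[OF frag_of_zero_rel[of "[]" 0]] by auto
  next
    case (gen P xs)
    then obtain x where "xs = [x]" "x \<in> L" by (auto simp: length_Suc_conv)
    with gen show ?case
      using L_sub by (intro bexI[of _ "P \<otimes> x"])
        (auto simp: spencer_diff_gen_Cons1 left_ideal_gen_def intro!: generate.incl)
  next
    case (diff x y)
    then obtain P Q where PQ: "P \<in> left_ideal_gen B L" "P \<in> carrier B" "Q \<in> left_ideal_gen B L" "Q \<in> carrier B"
      "chain_diff B x - frag_of (P, []) \<in> spencer_rel_group B R L 0"
      "chain_diff B y - frag_of (Q, []) \<in> spencer_rel_group B R L 0" by blast
    have "chain_diff B (x - y) - frag_of (P \<ominus> Q, []) =
        (chain_diff B x - frag_of (P, [])) - (chain_diff B y - frag_of (Q, []))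
        + (frag_of (P, []) - frag_of (Q, []) - frag_of (P \<ominus> Q, []))"
      by (simp add: frag_extend_diff)
    also have "\<dots> \<in> spencer_rel_group B R L 0"
      by (rule rel_add[OF rel_diff[OF PQ(5,6)] frag_of_diff_rel[OF PQ(2,4)]]) simp_all
    finally show ?case
      using PQ ideal_diff by (intro bexI[of _ "P \<ominus> Q"]) auto
  qed
  assume "\<exists>u\<in>spencer_chains B L 1. frag_of (P, []) - chain_diff B u \<in> spencer_rel_group B R L 0"
  then obtain u Q where u: "frag_of (P, []) - chain_diff B u \<in> spencer_rel_group B R L 0"
    and Q: "Q \<in> left_ideal_gen B L" "Q \<in> carrier B" "chain_diff B u - frag_of (Q, []) \<in> spencer_rel_group B R L 0"
    using * by blast
  have "frag_of (P \<ominus> Q, []) = (frag_of (P, []) - chain_diff B u) + (chain_diff B u - frag_of (Q, []))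
      - (frag_of (P, []) - frag_of (Q, []) - frag_of (P \<ominus> Q, []))"
    by simp
  also have "\<dots> \<in> spencer_rel_group B R L 0"
    by (rule rel_diff[OF rel_add[OF u Q(3)] frag_of_diff_rel[OF assms Q(2)]]) simp_all
  finally have "P \<ominus> Q = \<zero>" using assms Q frag_of_rel_0_iff by simp
  with assms Q show "P \<in> left_ideal_gen B L" by (simp add: r_right_minus_eq)
qed

end

lemma (in ring) no_torsion_iff:
  assumes I: "subgroup I (add_monoid R)" and s: "s \<in> carrier R"
    and sI: "\<And>x. x \<in> I \<Longrightarrow> s \<otimes> x \<in> I"
  shows "no_torsion R I s \<longleftrightarrow> (\<forall>P\<in>carrier R. s \<otimes> P \<in> I \<longrightarrow> P \<in> I)"
proof -
  interpret I: abelian_subgroup I R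
    by (rule abelian_subgroupI3) (simp_all add: additive_subgroup_def I abelian_group_axioms)
  have s_diff: "s \<otimes> x \<ominus> s \<otimes> y = s \<otimes> (x \<ominus> y)" if "x \<in> carrier R" "y \<in> carrier R" for x y
    using that s by (simp add: minus_eq r_distr r_minus)
  note mem_coset = I.a_rcos_module_minus[OF ring_axioms]
  have coset_eq: "I +> x = I +> y \<longleftrightarrow> x \<ominus> y \<in> I" if "x \<in> carrier R" "y \<in> carrier R" for x y
    using I.a_rcos_self[OF that(1)] I.a_repr_independence'[OF _ that(2), of x] mem_coset[OF that(2,1)]
    by metis
  have s_coset: "(\<Union>c\<in>I +> x. I +> (s \<otimes> c)) = I +> (s \<otimes> x)" if x: "x \<in> carrier R" for x
  proof -
    have "I +> (s \<otimes> c) = I +> (s \<otimes> x)" if c: "c \<in> I +> x" for c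
    proof -
      have cc: "c \<in> carrier R" using c a_r_coset_subset_G[OF I.a_subset x] by (rule rev_subsetD)
      have "s \<otimes> c \<ominus> s \<otimes> x = s \<otimes> (c \<ominus> x)" by (rule s_diff[OF cc x])
      also have "\<dots> \<in> I" using c mem_coset[OF x cc] by (intro sI) simp
      finally show ?thesis using x cc s by (simp add: coset_eq)
    qed
    then have "(\<Union>c\<in>I +> x. I +> (s \<otimes> c)) = (\<Union>c\<in>I +> x. I +> (s \<otimes> x))"
      by (rule SUP_cong[OF refl])
    moreover have "I +> x \<noteq> {}" using I.a_rcos_self[OF x] by blast
    ultimately show ?thesis by (simp only: UN_constant if_False)
  qed
  have carrier_Mod: "carrier (add_monoid R Mod I) = (\<lambda>x. I +> x) ` carrier R"
    by (simp add: carrier_FactGroup a_r_coset_def)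
  have inj: "no_torsion R I s \<longleftrightarrow> (\<forall>x\<in>carrier R. \<forall>y\<in>carrier R. s \<otimes> x \<ominus> s \<otimes> y \<in> I \<longrightarrow> x \<ominus> y \<in> I)"
    unfolding no_torsion_def carrier_Mod inj_on_def by (simp add: s_coset coset_eq s)
  show ?thesis
    unfolding inj
  proof (intro iffI ballI impI)
    fix P assume *: "\<forall>x\<in>carrier R. \<forall>y\<in>carrier R. s \<otimes> x \<ominus> s \<otimes> y \<in> I \<longrightarrow> x \<ominus> y \<in> I"
      and P: "P \<in> carrier R" "s \<otimes> P \<in> I"
    show "P \<in> I" using *[rule_format, OF P(1) zero_closed] P s by (simp add: minus_eq)
  next
    fix x y assume *: "\<forall>P\<in>carrier R. s \<otimes> P \<in> I \<longrightarrow> P \<in> I"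
      and xy: "x \<in> carrier R" "y \<in> carrier R" "s \<otimes> x \<ominus> s \<otimes> y \<in> I"
    from xy(3) have "s \<otimes> (x \<ominus> y) \<in> I" unfolding s_diff[OF xy(1,2)] .
    with * xy(1,2) show "x \<ominus> y \<in> I" by blast
  qed
qed



section \<open>Deformations along a central parameter\<close>

text \<open>
  The ring \<open>S\<close> is to be thought of as \<open>B[s]\<close>, with \<open>\<pi>\<close> the evaluation at \<open>s = 0\<close>, \<open>\<iota>\<close> the inclusion of the
  constants and \<open>\<sigma>\<close> the quotient of the division by \<open>s\<close>; injectivity of \<open>\<pi>\<close> on \<open>\<Theta>\<close> makes \<open>\<pi> ` \<Theta>\<close> a copy of \<open>\<Theta>\<close>.
\<close>

locale s_deformation =
  S: spencer_data S "\<iota> ` R" \<Theta> + B: spencer_data B R "\<pi> ` \<Theta>"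
  for S :: "('b, 'm) ring_scheme" and B :: "('c, 'k) ring_scheme" and R \<Theta> \<pi> \<iota> +
  fixes s :: 'b and \<sigma> :: "'b \<Rightarrow> 'b"
  assumes \<pi>_hom: "\<pi> \<in> ring_hom S B" and \<iota>_hom: "\<iota> \<in> ring_hom B S"
    and \<pi>_\<iota>: "b \<in> carrier B \<Longrightarrow> \<pi> (\<iota> b) = b"
    and \<pi>_inj: "inj_on \<pi> \<Theta>"
    and s_closed: "s \<in> carrier S" and s_central: "P \<in> carrier S \<Longrightarrow> s \<otimes>\<^bsub>S\<^esub> P = P \<otimes>\<^bsub>S\<^esub> s"
    and \<pi>_s: "\<pi> s = \<zero>\<^bsub>B\<^esub>"
    and \<sigma>_closed: "P \<in> carrier S \<Longrightarrow> \<sigma> P \<in> carrier S"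
    and \<sigma>_add: "P \<in> carrier S \<Longrightarrow> Q \<in> carrier S \<Longrightarrow> \<sigma> (P \<oplus>\<^bsub>S\<^esub> Q) = \<sigma> P \<oplus>\<^bsub>S\<^esub> \<sigma> Q"
    and \<sigma>_mult: "P \<in> carrier S \<Longrightarrow> a \<in> R \<Longrightarrow> \<sigma> (P \<otimes>\<^bsub>S\<^esub> \<iota> a) = \<sigma> P \<otimes>\<^bsub>S\<^esub> \<iota> a"
    and \<sigma>_s: "P \<in> carrier S \<Longrightarrow> \<sigma> (s \<otimes>\<^bsub>S\<^esub> P) = P"
    and decomp: "P \<in> carrier S \<Longrightarrow> P = \<iota> (\<pi> P) \<oplus>\<^bsub>S\<^esub> s \<otimes>\<^bsub>S\<^esub> \<sigma> P"
begin

text \<open>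
  On lists, \<open>\<iota>_chain\<close> inverts the bijection \<open>\<pi>\<close> from \<open>\<Theta>\<close> to \<open>\<pi> ` \<Theta>\<close>; it is not induced by \<open>\<iota>\<close>, and in general neither it
  nor \<open>\<sigma>_chain\<close> commutes with the differentials. Only \<open>s_chain\<close> and \<open>\<pi>_chain\<close> do.
\<close>

definition "s_chain = chain_map (\<lambda>P. s \<otimes>\<^bsub>S\<^esub> P) (\<lambda>x::'b. x)"
definition "\<sigma>_chain = chain_map \<sigma> (\<lambda>x::'b. x)"
definition "\<pi>_chain = chain_map \<pi> \<pi>"
definition "\<iota>_chain = chain_map \<iota> (inv_into \<Theta> \<pi>)"

lemmas chain_defs = s_chain_def \<sigma>_chain_def \<pi>_chain_def \<iota>_chain_def

lemma chain_simps [simp]: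
  "s_chain 0 = 0" "s_chain (x - y) = s_chain x - s_chain y"
  "\<sigma>_chain 0 = 0" "\<sigma>_chain (x - y) = \<sigma>_chain x - \<sigma>_chain y"
  "\<pi>_chain 0 = 0" "\<pi>_chain (x - y) = \<pi>_chain x - \<pi>_chain y"
  "\<iota>_chain 0 = 0" "\<iota>_chain (v - w) = \<iota>_chain v - \<iota>_chain w"
  by (simp_all add: chain_defs)

lemma \<Theta>_carrier: "x \<in> \<Theta> \<Longrightarrow> x \<in> carrier S"
  using S.L_sub by blast

lemma \<pi>_closed: "P \<in> carrier S \<Longrightarrow> \<pi> P \<in> carrier B"
  using ring_hom_closed[OF \<pi>_hom] .

lemma \<iota>_closed: "b \<in> carrier B \<Longrightarrow> \<iota> b \<in> carrier S"
  using ring_hom_closed[OF \<iota>_hom] .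

lemma inv_\<pi>: "inv_into \<Theta> \<pi> (\<pi> x) = x" if "x \<in> \<Theta>"
  using \<pi>_inj that by (rule inv_into_f_f)

lemma R_carrier: "a \<in> R \<Longrightarrow> a \<in> carrier B"
  using B.R_sub by blast

lemma s_chain_chains: "z \<in> spencer_chains S \<Theta> r \<Longrightarrow> s_chain z \<in> spencer_chains S \<Theta> r"
  unfolding s_chain_def by (erule chain_map_chains) (simp_all add: s_closed)

lemma \<sigma>_chain_chains: "z \<in> spencer_chains S \<Theta> r \<Longrightarrow> \<sigma>_chain z \<in> spencer_chains S \<Theta> r"
  unfolding \<sigma>_chain_def by (erule chain_map_chains) (simp_all add: \<sigma>_closed)

lemma \<pi>_chain_chains: "z \<in> spencer_chains S \<Theta> r \<Longrightarrow> \<pi>_chain z \<in> spencer_chains B (\<pi> ` \<Theta>) r"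
  unfolding \<pi>_chain_def by (erule chain_map_chains) (simp_all add: \<pi>_closed)

lemma \<iota>_chain_chains: "w \<in> spencer_chains B (\<pi> ` \<Theta>) r \<Longrightarrow> \<iota>_chain w \<in> spencer_chains S \<Theta> r"
  unfolding \<iota>_chain_def by (erule chain_map_chains) (simp_all add: \<iota>_closed inv_into_into)

lemma s_chain_rel:
  assumes "z \<in> spencer_rel_group S (\<iota> ` R) \<Theta> r"
  shows "s_chain z \<in> spencer_rel_group S (\<iota> ` R) \<Theta> r"
  unfolding s_chain_def
  by (rule chain_map_rel_group[OF S.spencer_data_axioms S.spencer_data_axioms,
        where \<gamma> = "\<lambda>a. a", OF _ _ _ _ _ _ _ assms])
    (auto simp: s_closed S.r_distr S.m_assoc \<iota>_closed R_carrier)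

lemma \<sigma>_chain_rel:
  assumes "z \<in> spencer_rel_group S (\<iota> ` R) \<Theta> r"
  shows "\<sigma>_chain z \<in> spencer_rel_group S (\<iota> ` R) \<Theta> r"
  unfolding \<sigma>_chain_def
  by (rule chain_map_rel_group[OF S.spencer_data_axioms S.spencer_data_axioms,
        where \<gamma> = "\<lambda>a. a", OF _ _ _ _ _ _ _ assms])
    (auto simp: \<sigma>_closed \<sigma>_add \<sigma>_mult)

lemma \<pi>_chain_rel:
  assumes "z \<in> spencer_rel_group S (\<iota> ` R) \<Theta> r"
  shows "\<pi>_chain z \<in> spencer_rel_group B R (\<pi> ` \<Theta>) r"
  unfolding \<pi>_chain_def
  by (rule chain_map_rel_group[OF S.spencer_data_axioms B.spencer_data_axioms,
        where \<gamma> = \<pi>, OF _ _ _ _ _ _ _ assms])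
    (auto simp: \<pi>_closed \<pi>_\<iota> R_carrier \<iota>_closed \<Theta>_carrier
      ring_hom_add[OF \<pi>_hom] ring_hom_mult[OF \<pi>_hom])

lemma \<iota>_chain_rel:
  assumes "w \<in> spencer_rel_group B R (\<pi> ` \<Theta>) r"
  shows "\<iota>_chain w \<in> spencer_rel_group S (\<iota> ` R) \<Theta> r"
proof -
  have add: "inv_into \<Theta> \<pi> (\<pi> x \<oplus>\<^bsub>B\<^esub> \<pi> y) = x \<oplus>\<^bsub>S\<^esub> y" if "x \<in> \<Theta>" "y \<in> \<Theta>" for x y
    using inv_\<pi>[OF S.L_add[OF that]] ring_hom_add[OF \<pi>_hom] \<Theta>_carrier that by simp
  have mult: "inv_into \<Theta> \<pi> (a \<otimes>\<^bsub>B\<^esub> \<pi> x) = \<iota> a \<otimes>\<^bsub>S\<^esub> x" if "a \<in> R" "x \<in> \<Theta>" for a x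
    using inv_\<pi>[OF S.L_mult[of "\<iota> a" x]] ring_hom_mult[OF \<pi>_hom] \<Theta>_carrier that
    by (simp add: \<pi>_\<iota> R_carrier \<iota>_closed)
  show ?thesis
    unfolding \<iota>_chain_def
    by (rule chain_map_rel_group[OF B.spencer_data_axioms S.spencer_data_axioms,
        where \<gamma> = \<iota>, OF _ _ _ _ _ _ _ assms])
      (auto simp: \<iota>_closed R_carrier inv_\<pi> add mult
        ring_hom_add[OF \<iota>_hom] ring_hom_mult[OF \<iota>_hom])
qed

text \<open>
  Since \<open>\<sigma>_chain\<close> preserves the relations, this shows that multiplication by \<open>s\<close> is injective on the terms
  of the complex over \<open>S\<close>.
\<close>

lemma \<sigma>_s_chain:
  assumes "z \<in> spencer_chains S \<Theta> r"
  shows "\<sigma>_chain (s_chain z) = z"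
  using assms
  by (induction rule: spencer_chains_induct) (simp_all add: chain_defs \<sigma>_s)

lemma \<pi>_\<iota>_chain:
  assumes "w \<in> spencer_chains B (\<pi> ` \<Theta>) r"
  shows "\<pi>_chain (\<iota>_chain w) = w"
  using assms
proof (induction rule: spencer_chains_induct)
  case (gen P xs)
  have "map (\<pi> \<circ> inv_into \<Theta> \<pi>) xs = xs"
    using gen(3) by (intro map_idI) (auto simp: f_inv_into_f)
  with gen show ?case by (simp add: chain_defs \<pi>_\<iota>)
qed simp_all

lemma \<pi>_s_chain:
  assumes "z \<in> spencer_chains S \<Theta> r"
  shows "\<pi>_chain (s_chain z) \<in> spencer_rel_group B R (\<pi> ` \<Theta>) r"
  using assms
proof (induction rule: spencer_chains_induct)
  case (gen P xs)
  have "\<pi>_chain (s_chain (frag_of (P, xs))) = frag_of (\<zero>\<^bsub>B\<^esub>, map \<pi> xs)"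
    using gen by (simp add: chain_defs ring_hom_mult[OF \<pi>_hom] s_closed \<pi>_s \<pi>_closed)
  moreover have "frag_of (\<zero>\<^bsub>B\<^esub>, map \<pi> xs) \<in> spencer_rel_group B R (\<pi> ` \<Theta>) r"
    using gen by (intro B.frag_of_zero_rel) auto
  ultimately show ?case by simp
qed (simp_all add: B.rel_diff)

text \<open>
  Exactness of the short exact sequence in the middle: if \<open>\<pi>_chain z\<close> is a relation, so is
  \<open>\<iota>_chain (\<pi>_chain z)\<close>, and \<open>z\<close> is a multiple of \<open>s\<close> modulo relations.
\<close>

lemma decomp_chain:
  assumes "z \<in> spencer_chains S \<Theta> r"
  shows "z - \<iota>_chain (\<pi>_chain z) - s_chain (\<sigma>_chain z) \<in> spencer_rel_group S (\<iota> ` R) \<Theta> r"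
  using assms
proof (induction rule: spencer_chains_induct)
  case (gen P xs)
  have map: "map (inv_into \<Theta> \<pi> \<circ> \<pi>) xs = xs"
    using gen(3) by (intro map_idI) (auto simp: inv_\<pi>)
  have "frag_of (\<iota> (\<pi> P) \<oplus>\<^bsub>S\<^esub> s \<otimes>\<^bsub>S\<^esub> \<sigma> P, xs) - frag_of (\<iota> (\<pi> P), xs) - frag_of (s \<otimes>\<^bsub>S\<^esub> \<sigma> P, xs)
      \<in> spencer_rel_group S (\<iota> ` R) \<Theta> r"
    using gen by (intro S.frag_of_add_rel) (simp_all add: \<iota>_closed \<pi>_closed \<sigma>_closed s_closed)
  then show ?case
    unfolding decomp[OF gen(1), symmetric] by (simp add: chain_defs map)
next
  case (diff x y)
  have "x - y - \<iota>_chain (\<pi>_chain (x - y)) - s_chain (\<sigma>_chain (x - y)) =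
    (x - \<iota>_chain (\<pi>_chain x) - s_chain (\<sigma>_chain x)) - (y - \<iota>_chain (\<pi>_chain y) - s_chain (\<sigma>_chain y))"
    by simp
  also have "\<dots> \<in> spencer_rel_group S (\<iota> ` R) \<Theta> r"
    by (rule S.rel_diff[OF diff(3,4)])
  finally show ?case .
qed simp

lemma chain_diff_s_chain:
  assumes "z \<in> spencer_chains S \<Theta> r"
  shows "chain_diff S (s_chain z) = s_chain (chain_diff S z)"
  using assms
proof (induction rule: spencer_chains_induct)
  case (gen P xs)
  have "xs ! i \<in> carrier S" if "i < length xs" for i
    using that gen(3) nth_mem[OF that] \<Theta>_carrier by blast
  with gen show ?case
    by (simp add: chain_defs spencer_diff_gen_def chain_map_sum S.m_assoc s_closed)
qed (simp_all add: frag_extend_diff)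

text \<open>
  The equality holds already on chains: \<open>\<pi>\<close> is a ring homomorphism, so it commutes with the products and
  with the commutators in the differential.
\<close>

lemma chain_diff_\<pi>_chain:
  assumes "z \<in> spencer_chains S \<Theta> r"
  shows "chain_diff B (\<pi>_chain z) = \<pi>_chain (chain_diff S z)"
  using assms
proof (induction rule: spencer_chains_induct)
  case (gen P xs)
  have xs: "xs ! i \<in> carrier S" if "i < length xs" for i
    using that gen(3) nth_mem[OF that] \<Theta>_carrier by blast
  interpret \<pi>: ring_hom_ring S B \<pi>
    by (intro ring_hom_ringI2 S.ring_axioms B.ring_axioms \<pi>_hom)
  have "\<pi> (x \<ominus>\<^bsub>S\<^esub> y) = \<pi> x \<ominus>\<^bsub>B\<^esub> \<pi> y" if "x \<in> carrier S" "y \<in> carrier S" for x y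
    using that by (simp add: a_minus_def)
  with gen xs show ?case
    by (simp add: chain_defs spencer_diff_gen_def chain_map_sum nths_map \<pi>.hom_mult)
qed (simp_all add: frag_extend_diff)

end


section \<open>The long exact sequence\<close>

context s_deformation
begin

abbreviation "RelS \<equiv> spencer_rel_group S (\<iota> ` R) \<Theta>"
abbreviation "RelB \<equiv> spencer_rel_group B R (\<pi> ` \<Theta>)"
abbreviation "ChS \<equiv> spencer_chains S \<Theta>"
abbreviation "ChB \<equiv> spencer_chains B (\<pi> ` \<Theta>)"

text \<open>
  Multiplication by \<open>s\<close> is injective on the cokernel of the differential from degree \<open>-(r+1)\<close> to degree \<open>-r\<close>. In
  degree zero this is the absence of torsion; in degrees \<open>-r\<close> with \<open>r \<ge> 1\<close> it follows from the exactness of the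
  complex over \<open>S\<close>. Given that exactness, it is equivalent to exactness over \<open>B\<close> one degree further left
  (\<open>exact_B_if_s_regular\<close>, \<open>s_regular_if_exact_B\<close>).
\<close>

definition s_regular :: "nat \<Rightarrow> bool" where
  "s_regular r \<longleftrightarrow> (\<forall>y\<in>ChS r. \<forall>z\<in>ChS (r + 1).
     s_chain y - chain_diff S z \<in> RelS r \<longrightarrow>
     (\<exists>u\<in>ChS (r + 1). y - chain_diff S u \<in> RelS r))"

lemma s_regular_0_iff:
  "s_regular 0 \<longleftrightarrow> no_torsion S (left_ideal_gen S \<Theta>) s"
proof -
  have gen_sub: "{P \<otimes>\<^bsub>S\<^esub> x | P x. P \<in> carrier S \<and> x \<in> \<Theta>} \<subseteq> carrier (add_monoid S)"
    using S.L_sub by auto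
  have sub: "subgroup (left_ideal_gen S \<Theta>) (add_monoid S)"
    unfolding left_ideal_gen_def by (rule group.generate_is_subgroup[OF S.a_group gen_sub])
  have mem: "P \<in> left_ideal_gen S \<Theta> \<longleftrightarrow>
    (\<exists>u\<in>ChS 1. frag_of (P, []) - chain_diff S u \<in> RelS 0)" if "P \<in> carrier S" for P
    using S.left_ideal_gen_iff[OF that] .
  have s_mult: "s \<otimes>\<^bsub>S\<^esub> x \<in> left_ideal_gen S \<Theta>" if "x \<in> left_ideal_gen S \<Theta>" for x
  proof -
    have x: "x \<in> carrier S" using that subgroup.subset[OF sub] by auto
    with that obtain u where u: "u \<in> ChS 1" "frag_of (x, []) - chain_diff S u \<in> RelS 0"
      using mem by blast
    have "frag_of (s \<otimes>\<^bsub>S\<^esub> x, []) - chain_diff S (s_chain u) = s_chain (frag_of (x, []) - chain_diff S u)"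
      unfolding chain_diff_s_chain[OF u(1)] by (simp add: s_chain_def)
    also have "\<dots> \<in> RelS 0" by (rule s_chain_rel[OF u(2)])
    finally show ?thesis
      using mem[of "s \<otimes>\<^bsub>S\<^esub> x"] x s_closed s_chain_chains[OF u(1)] by auto
  qed
  have "no_torsion S (left_ideal_gen S \<Theta>) s \<longleftrightarrow>
      (\<forall>P\<in>carrier S. s \<otimes>\<^bsub>S\<^esub> P \<in> left_ideal_gen S \<Theta> \<longrightarrow> P \<in> left_ideal_gen S \<Theta>)"
    by (rule S.no_torsion_iff[OF sub s_closed s_mult])
  also have "\<dots> \<longleftrightarrow> s_regular 0"
  proof
    assume *: "\<forall>P\<in>carrier S. s \<otimes>\<^bsub>S\<^esub> P \<in> left_ideal_gen S \<Theta> \<longrightarrow> P \<in> left_ideal_gen S \<Theta>"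
    show "s_regular 0"
      unfolding s_regular_def
    proof (intro ballI impI)
      fix y z assume y: "y \<in> ChS 0" and z: "z \<in> ChS (0 + 1)" "s_chain y - chain_diff S z \<in> RelS 0"
      obtain P where P: "P \<in> carrier S" "y - frag_of (P, []) \<in> RelS 0"
        using S.chains_0_normal_form[OF y] by blast
      have "frag_of (s \<otimes>\<^bsub>S\<^esub> P, []) - chain_diff S z =
          (s_chain y - chain_diff S z) - s_chain (y - frag_of (P, []))"
        by (simp add: s_chain_def)
      also have "\<dots> \<in> RelS 0" by (rule S.rel_diff[OF z(2) s_chain_rel[OF P(2)]])
      finally have "s \<otimes>\<^bsub>S\<^esub> P \<in> left_ideal_gen S \<Theta>"
        using mem[of "s \<otimes>\<^bsub>S\<^esub> P"] P(1) s_closed z(1) by auto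
      with * P(1) mem obtain u where u: "u \<in> ChS 1" "frag_of (P, []) - chain_diff S u \<in> RelS 0"
        by blast
      have "y - chain_diff S u = (y - frag_of (P, [])) + (frag_of (P, []) - chain_diff S u)"
        by simp
      also have "\<dots> \<in> RelS 0" by (rule S.rel_add[OF P(2) u(2)])
      finally show "\<exists>u\<in>ChS (0 + 1). y - chain_diff S u \<in> RelS 0" using u(1) by auto
    qed
  next
    assume reg: "s_regular 0"
    show "\<forall>P\<in>carrier S. s \<otimes>\<^bsub>S\<^esub> P \<in> left_ideal_gen S \<Theta> \<longrightarrow> P \<in> left_ideal_gen S \<Theta>"
    proof (intro ballI impI)
      fix P assume P: "P \<in> carrier S" "s \<otimes>\<^bsub>S\<^esub> P \<in> left_ideal_gen S \<Theta>"
      then obtain z where z: "z \<in> ChS 1" "frag_of (s \<otimes>\<^bsub>S\<^esub> P, []) - chain_diff S z \<in> RelS 0"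
        using mem[of "s \<otimes>\<^bsub>S\<^esub> P"] s_closed by auto
      have "frag_of (P, []) \<in> ChS 0" using P by (simp add: spencer_gens_def)
      moreover have "s_chain (frag_of (P, [])) - chain_diff S z \<in> RelS 0"
        using z(2) by (simp add: s_chain_def)
      ultimately have "\<exists>u\<in>ChS 1. frag_of (P, []) - chain_diff S u \<in> RelS 0"
        using reg z(1) unfolding s_regular_def by auto
      then show "P \<in> left_ideal_gen S \<Theta>" using mem[OF P(1)] by blast
    qed
  qed
  finally show ?thesis ..
qed

context
  assumes exact_S: "\<And>r. r \<ge> 1 \<Longrightarrow> spencer_exact S (\<iota> ` R) \<Theta> r"
begin

text \<open>
  By induction, since \<open>spencer_exact_iff\<close> in degree \<open>-r\<close> presupposes that the differential leaving degree \<open>-r\<close>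
  respects the relations and yields the same for the one entering it.
\<close>

lemma chain_diff_rel_S:
  "m \<in> RelS (Suc r) \<Longrightarrow> chain_diff S m \<in> RelS r"
proof (induction r arbitrary: m)
  case 0
  then show ?case using S.chain_diff_rel_1 by simp
next
  case (Suc r)
  then show ?case
    using S.spencer_exact_iff[of "Suc r"] exact_S[of "Suc r"] by simp
qed

lemma exactness_S:
  shows "v \<in> ChS (Suc (Suc r)) \<Longrightarrow> chain_diff S v \<in> ChS (Suc r)"
    and "v \<in> ChS (Suc (Suc r)) \<Longrightarrow> chain_diff S (chain_diff S v) \<in> RelS r"
    and "z \<in> ChS (Suc r) \<Longrightarrow> chain_diff S z \<in> RelS r \<Longrightarrow>
      \<exists>v\<in>ChS (Suc (Suc r)). z - chain_diff S v \<in> RelS (Suc r)"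
  using S.spencer_exact_iff[of "Suc r"] exact_S[of "Suc r"] chain_diff_rel_S by simp_all

lemma chain_diff_chains_S: "v \<in> ChS (Suc r) \<Longrightarrow> chain_diff S v \<in> ChS r"
  using S.chain_diff_chains_1 exactness_S(1) by (cases r) simp_all

lemma chain_diff_rel_B:
  assumes "m \<in> RelB (Suc r)" shows "chain_diff B m \<in> RelB r"
proof -
  have "chain_diff B m = \<pi>_chain (chain_diff S (\<iota>_chain m))"
    using \<pi>_\<iota>_chain[OF B.rel_chain[OF assms]]
      chain_diff_\<pi>_chain[OF \<iota>_chain_chains[OF B.rel_chain[OF assms]]] by simp
  also have "\<dots> \<in> RelB r"
    by (intro \<pi>_chain_rel chain_diff_rel_S \<iota>_chain_rel assms)
  finally show ?thesis .
qed

text \<open>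
  Diagram chase: lift a cycle \<open>w\<close> over \<open>B\<close> to a chain \<open>z\<close> over \<open>S\<close>. Its differential vanishes at \<open>s = 0\<close>, so it is
  \<open>s y\<close> modulo relations, and regularity writes \<open>y\<close> as the differential of some \<open>u\<close>. Then \<open>z - s u\<close> is a cycle over
  \<open>S\<close> with the same value \<open>w\<close> at \<open>s = 0\<close>, hence a boundary.
\<close>

lemma exact_B_if_s_regular:
  assumes "s_regular r"
  shows "spencer_exact B R (\<pi> ` \<Theta>) (Suc r)"
proof -
  have lift: "\<exists>v'\<in>ChS k. \<pi>_chain v' = v" if "v \<in> ChB k" for v k
    using \<pi>_\<iota>_chain[OF that] \<iota>_chain_chains[OF that] by blast
  have dd: "chain_diff B v \<in> ChB (Suc r) \<and> chain_diff B (chain_diff B v) \<in> RelB r"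
    if v: "v \<in> ChB (Suc (Suc r))" for v
  proof -
    obtain v' where v': "v' \<in> ChS (Suc (Suc r))" "\<pi>_chain v' = v" using lift[OF v] by blast
    note d = exactness_S(1,2)[OF v'(1)]
    have "chain_diff B v = \<pi>_chain (chain_diff S v')"
      using chain_diff_\<pi>_chain[OF v'(1)] v'(2) by simp
    then show ?thesis
      using \<pi>_chain_chains[OF d(1)] chain_diff_\<pi>_chain[OF d(1)] \<pi>_chain_rel[OF d(2)] by simp
  qed
  have ex: "\<exists>v\<in>ChB (Suc (Suc r)). w - chain_diff B v \<in> RelB (Suc r)"
    if w: "w \<in> ChB (Suc r)" "chain_diff B w \<in> RelB r" for w
  proof -
    obtain z where z: "z \<in> ChS (Suc r)" "\<pi>_chain z = w" using lift[OF w(1)] by blast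
    note dz = chain_diff_chains_S[OF z(1)]
    have y: "\<sigma>_chain (chain_diff S z) \<in> ChS r"
      by (rule \<sigma>_chain_chains[OF dz])
    \<comment> \<open>The differential of the lift vanishes at \<open>s = 0\<close>, so it is divisible by \<open>s\<close>.\<close>
    have "\<pi>_chain (chain_diff S z) \<in> RelB r"
      using w(2) z chain_diff_\<pi>_chain[OF z(1)] by simp
    then have "chain_diff S z - s_chain (\<sigma>_chain (chain_diff S z)) \<in> RelS r"
      using S.rel_add[OF decomp_chain[OF dz] \<iota>_chain_rel[of "\<pi>_chain (chain_diff S z)"]] by simp
    from S.rel_minus[OF this]
    have div: "s_chain (\<sigma>_chain (chain_diff S z)) - chain_diff S z \<in> RelS r" by simp
    with assms y z(1) obtain u where u: "u \<in> ChS (Suc r)"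
      "\<sigma>_chain (chain_diff S z) - chain_diff S u \<in> RelS r"
      unfolding s_regular_def Suc_eq_plus1 by blast
    note su = s_chain_chains[OF u(1)]
    have "chain_diff S (z - s_chain u) =
        s_chain (\<sigma>_chain (chain_diff S z) - chain_diff S u) -
        (s_chain (\<sigma>_chain (chain_diff S z)) - chain_diff S z)"
      by (simp add: frag_extend_diff chain_diff_s_chain[OF u(1)])
    also have "\<dots> \<in> RelS r"
      by (rule S.rel_diff[OF s_chain_rel[OF u(2)] div])
    finally obtain v where v: "v \<in> ChS (Suc (Suc r))" "z - s_chain u - chain_diff S v \<in> RelS (Suc r)"
      using exactness_S(3)[OF spencer_chains_diff[OF z(1) su]] by blast
    have "w - chain_diff B (\<pi>_chain v) = \<pi>_chain (z - s_chain u - chain_diff S v) + \<pi>_chain (s_chain u)"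
      using z(2) chain_diff_\<pi>_chain[OF v(1)] by simp
    also have "\<dots> \<in> RelB (Suc r)"
      by (intro B.rel_add \<pi>_chain_rel v(2) \<pi>_s_chain[OF u(1)])
    finally show ?thesis using \<pi>_chain_chains[OF v(1)] by blast
  qed
  show ?thesis
    using B.spencer_exact_iff[of "Suc r"] chain_diff_rel_B dd ex by simp
qed

text \<open>
  Conversely, if \<open>s y\<close> is the differential of \<open>z\<close>, then \<open>z\<close> is a cycle at \<open>s = 0\<close>, hence a boundary there. Subtracting
  a lift of that boundary turns \<open>z\<close> into a multiple \<open>s u\<close> with the same differential, and \<open>s\<close> can be cancelled.
\<close>

lemma s_regular_if_exact_B:
  assumes "spencer_exact B R (\<pi> ` \<Theta>) (Suc r)"
  shows "s_regular r"
  unfolding s_regular_def Suc_eq_plus1[symmetric]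
proof (intro ballI impI)
  have exact_B: "\<exists>v\<in>ChB (Suc (Suc r)). w - chain_diff B v \<in> RelB (Suc r)"
    if "w \<in> ChB (Suc r)" "chain_diff B w \<in> RelB r" for w
    using B.spencer_exact_iff[of "Suc r"] chain_diff_rel_B assms that by simp
  fix y z assume y: "y \<in> ChS r" and z: "z \<in> ChS (Suc r)" "s_chain y - chain_diff S z \<in> RelS r"
  have "chain_diff B (\<pi>_chain z) = \<pi>_chain (s_chain y) - \<pi>_chain (s_chain y - chain_diff S z)"
    by (simp add: chain_diff_\<pi>_chain[OF z(1)])
  also have "\<dots> \<in> RelB r"
    by (intro B.rel_diff \<pi>_s_chain[OF y] \<pi>_chain_rel z(2))
  finally obtain v where v: "v \<in> ChB (Suc (Suc r))" "\<pi>_chain z - chain_diff B v \<in> RelB (Suc r)"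
    using exact_B[OF \<pi>_chain_chains[OF z(1)]] by blast
  define v' where "v' = \<iota>_chain v"
  have v': "v' \<in> ChS (Suc (Suc r))" "\<pi>_chain v' = v"
    unfolding v'_def using \<iota>_chain_chains[OF v(1)] \<pi>_\<iota>_chain[OF v(1)] by simp_all
  note dv' = exactness_S(1,2)[OF v'(1)]
  define t where "t = z - chain_diff S v'"
  have t: "t \<in> ChS (Suc r)"
    unfolding t_def by (rule spencer_chains_diff[OF z(1) dv'(1)])
  have "\<pi>_chain t \<in> RelB (Suc r)"
    using v(2) v'(2) by (simp add: t_def chain_diff_\<pi>_chain[OF v'(1), symmetric])
  define u where "u = \<sigma>_chain t"
  have u: "u \<in> ChS (Suc r)" unfolding u_def by (rule \<sigma>_chain_chains[OF t])
  have tu: "t - s_chain u \<in> RelS (Suc r)"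
    unfolding u_def
    using S.rel_add[OF decomp_chain[OF t] \<iota>_chain_rel[OF \<open>\<pi>_chain t \<in> RelB (Suc r)\<close>]] by simp
  have "s_chain (y - chain_diff S u) =
      (s_chain y - chain_diff S z) + chain_diff S (t - s_chain u) + chain_diff S (chain_diff S v')"
    by (simp add: t_def frag_extend_diff chain_diff_s_chain[OF u])
  also have "\<dots> \<in> RelS r"
    by (intro S.rel_add z(2) chain_diff_rel_S[OF tu] dv'(2))
  finally have "\<sigma>_chain (s_chain (y - chain_diff S u)) \<in> RelS r"
    by (rule \<sigma>_chain_rel)
  then have "y - chain_diff S u \<in> RelS r"
    unfolding \<sigma>_s_chain[OF spencer_chains_diff[OF y chain_diff_chains_S[OF u]]] .
  with u show "\<exists>u\<in>ChS (Suc r). y - chain_diff S u \<in> RelS r" by blast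
qed

text \<open>
  If \<open>s y\<close> is a boundary, then \<open>s\<close> times the differential of \<open>y\<close> vanishes, so \<open>y\<close> is a cycle and therefore a boundary.
\<close>

lemma s_regular_Suc: "s_regular (Suc r)"
  unfolding s_regular_def Suc_eq_plus1[symmetric]
proof (intro ballI impI)
  fix y z assume y: "y \<in> ChS (Suc r)" and z: "z \<in> ChS (Suc (Suc r))"
    "s_chain y - chain_diff S z \<in> RelS (Suc r)"
  note dy = chain_diff_chains_S[OF y]
  have "s_chain (chain_diff S y) = chain_diff S (s_chain y - chain_diff S z) + chain_diff S (chain_diff S z)"
    by (simp add: frag_extend_diff chain_diff_s_chain[OF y])
  also have "\<dots> \<in> RelS r"
    by (intro S.rel_add chain_diff_rel_S[OF z(2)] exactness_S(2)[OF z(1)])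
  finally have "\<sigma>_chain (s_chain (chain_diff S y)) \<in> RelS r"
    by (rule \<sigma>_chain_rel)
  then have "chain_diff S y \<in> RelS r"
    unfolding \<sigma>_s_chain[OF dy] .
  then show "\<exists>u\<in>ChS (Suc (Suc r)). y - chain_diff S u \<in> RelS (Suc r)"
    by (rule exactness_S(3)[OF y])
qed

lemma exact_1_iff_no_torsion:
  "spencer_exact B R (\<pi> ` \<Theta>) 1 \<longleftrightarrow> no_torsion S (left_ideal_gen S \<Theta>) s"
  using exact_B_if_s_regular[of 0] s_regular_if_exact_B[of 0] s_regular_0_iff by auto

lemma exact_above_1:
  assumes "r \<ge> 2" shows "spencer_exact B R (\<pi> ` \<Theta>) r"
proof -
  obtain k where "r = Suc (Suc k)" using assms that[of "r - 2"] by simp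
  then show ?thesis using exact_B_if_s_regular[OF s_regular_Suc[of k]] by simp
qed

end

end


section \<open>Polynomial rings as deformations\<close>

context UP_ring
begin

lemma coeff_monom_times:
  assumes "a \<in> carrier R" "q \<in> carrier P"
  shows "coeff P (monom P a m \<otimes>\<^bsub>P\<^esub> q) n = (if m \<le> n then a \<otimes> coeff P q (n - m) else \<zero>)"
proof -
  have "coeff P (monom P a m \<otimes>\<^bsub>P\<^esub> q) n = (\<Oplus>i\<in>{..n}. if m = i then a \<otimes> coeff P q (n - i) else \<zero>)"
    using assms by (simp, intro R.finsum_cong') (auto simp: Pi_def)
  also have "\<dots> = (if m \<le> n then a \<otimes> coeff P q (n - m) else \<zero>)"
  proof (cases "m \<le> n")
    case True
    then show ?thesis
      using R.add.finprod_singleton[of m "{..n}" "\<lambda>i. a \<otimes> coeff P q (n - i)"] assms by simp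
  next
    case False
    then have "(\<Oplus>i\<in>{..n}. if m = i then a \<otimes> coeff P q (n - i) else \<zero>) = (\<Oplus>i\<in>{..n}. \<zero>)"
      by (intro R.finsum_cong') auto
    with False show ?thesis by simp
  qed
  finally show ?thesis .
qed

lemma coeff_times_monom:
  assumes "a \<in> carrier R" "q \<in> carrier P"
  shows "coeff P (q \<otimes>\<^bsub>P\<^esub> monom P a m) n = (if m \<le> n then coeff P q (n - m) \<otimes> a else \<zero>)"
proof (cases "m \<le> n")
  case True
  have "coeff P (q \<otimes>\<^bsub>P\<^esub> monom P a m) n = (\<Oplus>i\<in>{..n}. if n - m = i then coeff P q i \<otimes> a else \<zero>)"
    using assms True by (simp, intro R.finsum_cong') (auto simp: Pi_def)
  also have "\<dots> = coeff P q (n - m) \<otimes> a"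
    using R.add.finprod_singleton[of "n - m" "{..n}" "\<lambda>i. coeff P q i \<otimes> a"] assms by simp
  finally show ?thesis using True by simp
next
  case False
  have "(\<Oplus>i\<in>{..n}. coeff P q i \<otimes> coeff P (monom P a m) (n - i)) = (\<Oplus>i\<in>{..n}. \<zero>)"
    using assms False by (intro R.finsum_cong') auto
  with False assms show ?thesis by simp
qed

lemma shift_closed:
  assumes "q \<in> carrier P" shows "(\<lambda>n. q (Suc n)) \<in> carrier P"
proof -
  have q: "q \<in> up R" using assms by (simp add: P_def UP_def)
  then obtain k where "bound \<zero> k q" by (auto simp: up_def)
  then have "bound \<zero> k (\<lambda>n. q (Suc n))" by (auto simp: bound_def)
  with q have "(\<lambda>n. q (Suc n)) \<in> up R" by (auto simp: up_def)
  then show ?thesis by (simp add: P_def UP_def)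
qed

lemma coeff_shift:
  assumes "q \<in> carrier P" shows "coeff P (\<lambda>n. q (Suc n)) n = coeff P q (Suc n)"
  using assms shift_closed[OF assms] by (simp add: P_def UP_def)

lemma coeff_0_hom: "(\<lambda>q. coeff P q 0) \<in> ring_hom P R"
  by (rule ring_hom_memI) simp_all

lemma monom_0_hom: "(\<lambda>b. monom P b 0) \<in> ring_hom R P"
proof (rule ring_hom_memI)
  fix x y assume "x \<in> carrier R" "y \<in> carrier R"
  then show "monom P (x \<otimes> y) 0 = monom P x 0 \<otimes>\<^bsub>P\<^esub> monom P y 0"
    "monom P (x \<oplus> y) 0 = monom P x 0 \<oplus>\<^bsub>P\<^esub> monom P y 0"
    by (auto intro!: up_eqI simp: coeff_monom_times simp del: coeff_mult)
qed (auto intro!: up_eqI)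

end

text \<open>
  Polynomials are functions from exponents to coefficients, so the division by \<open>s\<close> is the shift of the
  exponent by one.
\<close>

lemma UP_s_deformation:
  fixes B :: "('c, 'k) ring_scheme"
  assumes "ring B" and R: "R \<subseteq> carrier B" and \<Theta>: "\<Theta> \<subseteq> carrier (UP B)"
    and \<Theta>_add: "\<And>x y. x \<in> \<Theta> \<Longrightarrow> y \<in> \<Theta> \<Longrightarrow> x \<oplus>\<^bsub>UP B\<^esub> y \<in> \<Theta>"
    and \<Theta>_mult: "\<And>a x. a \<in> R \<Longrightarrow> x \<in> \<Theta> \<Longrightarrow> monom (UP B) a 0 \<otimes>\<^bsub>UP B\<^esub> x \<in> \<Theta>"
    and inj: "inj_on (\<lambda>q. coeff (UP B) q 0) \<Theta>"
  shows "s_deformation (UP B) B R \<Theta> (\<lambda>q. coeff (UP B) q 0) (\<lambda>b. monom (UP B) b 0)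
    (monom (UP B) \<one>\<^bsub>B\<^esub> 1) (\<lambda>q n. q (Suc n))"
proof -
  interpret B: UP_ring B "UP B"
    using \<open>ring B\<close> by (simp add: UP_ring_def)
  interpret S: ring "UP B" by (rule B.UP_ring)
  have \<Theta>_carrier: "x \<in> carrier (UP B)" if "x \<in> \<Theta>" for x using that \<Theta> by blast
  have R_carrier: "a \<in> carrier B" if "a \<in> R" for a using that R by blast
  show ?thesis
  proof (unfold_locales)
    fix u v assume "u \<in> (\<lambda>q. coeff (UP B) q 0) ` \<Theta>" "v \<in> (\<lambda>q. coeff (UP B) q 0) ` \<Theta>"
    then obtain x y where xy: "x \<in> \<Theta>" "y \<in> \<Theta>" "u = coeff (UP B) x 0" "v = coeff (UP B) y 0" by blast
    then have "u \<oplus>\<^bsub>B\<^esub> v = coeff (UP B) (x \<oplus>\<^bsub>UP B\<^esub> y) 0" using \<Theta>_carrier by simp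
    with \<Theta>_add xy show "u \<oplus>\<^bsub>B\<^esub> v \<in> (\<lambda>q. coeff (UP B) q 0) ` \<Theta>" by blast
  next
    fix a u assume a: "a \<in> R" and "u \<in> (\<lambda>q. coeff (UP B) q 0) ` \<Theta>"
    then obtain x where x: "x \<in> \<Theta>" "u = coeff (UP B) x 0" by blast
    then have "a \<otimes>\<^bsub>B\<^esub> u = coeff (UP B) (monom (UP B) a 0 \<otimes>\<^bsub>UP B\<^esub> x) 0"
      using \<Theta>_carrier R_carrier a by (simp add: B.coeff_monom_times del: B.coeff_mult)
    with \<Theta>_mult x a show "a \<otimes>\<^bsub>B\<^esub> u \<in> (\<lambda>q. coeff (UP B) q 0) ` \<Theta>" by blast
  next
    fix q assume "q \<in> carrier (UP B)"
    then show "monom (UP B) \<one>\<^bsub>B\<^esub> 1 \<otimes>\<^bsub>UP B\<^esub> q = q \<otimes>\<^bsub>UP B\<^esub> monom (UP B) \<one>\<^bsub>B\<^esub> 1"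
      by (intro B.up_eqI)
        (simp_all add: B.coeff_monom_times B.coeff_times_monom del: B.coeff_mult)
    show "(\<lambda>n. q (Suc n)) \<in> carrier (UP B)"
      using \<open>q \<in> carrier (UP B)\<close> by (rule B.shift_closed)
  next
    fix p q assume "p \<in> carrier (UP B)" "q \<in> carrier (UP B)"
    then show "(\<lambda>n. (p \<oplus>\<^bsub>UP B\<^esub> q) (Suc n)) = (\<lambda>n. p (Suc n)) \<oplus>\<^bsub>UP B\<^esub> (\<lambda>n. q (Suc n))"
      by (intro B.up_eqI) (simp_all add: B.coeff_shift B.shift_closed)
  next
    fix q a assume "q \<in> carrier (UP B)" "a \<in> R"
    then show "(\<lambda>n. (q \<otimes>\<^bsub>UP B\<^esub> monom (UP B) a 0) (Suc n)) =
        (\<lambda>n. q (Suc n)) \<otimes>\<^bsub>UP B\<^esub> monom (UP B) a 0"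
      using R_carrier
      by (intro B.up_eqI)
        (simp_all add: B.coeff_shift B.shift_closed B.coeff_times_monom del: B.coeff_mult)
  next
    fix q assume "q \<in> carrier (UP B)"
    then show "(\<lambda>n. (monom (UP B) \<one>\<^bsub>B\<^esub> 1 \<otimes>\<^bsub>UP B\<^esub> q) (Suc n)) = q"
      by (intro B.up_eqI)
        (simp_all add: B.coeff_shift B.shift_closed B.coeff_monom_times del: B.coeff_mult)
  next
    fix q assume "q \<in> carrier (UP B)"
    then show "q = monom (UP B) (coeff (UP B) q 0) 0 \<oplus>\<^bsub>UP B\<^esub>
        monom (UP B) \<one>\<^bsub>B\<^esub> 1 \<otimes>\<^bsub>UP B\<^esub> (\<lambda>n. q (Suc n))"
      by (intro B.up_eqI)
        (auto simp: B.coeff_shift B.shift_closed B.coeff_monom_times not_less_eq_eq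
          simp del: B.coeff_mult)
  qed (use assms R_carrier \<Theta>_carrier in \<open>auto simp: B.coeff_0_hom B.monom_0_hom\<close>)
qed


section \<open>Stalks of holomorphic functions and their endomorphisms\<close>

lemma holomorphic_in_mono: "holomorphic_in S F \<Longrightarrow> T \<subseteq> S \<Longrightarrow> holomorphic_in T F"
  unfolding holomorphic_in_def by blast

lemma holomorphic_in_const: "holomorphic_in S (\<lambda>_. c)"
  unfolding holomorphic_in_def by (auto intro!: exI[of _ "\<lambda>_. 0"])

lemma holomorphic_in_add:
  assumes "holomorphic_in S F" "holomorphic_in S G"
  shows "holomorphic_in S (\<lambda>z. F z + G z)"
  unfolding holomorphic_in_def
proof
  fix z assume "z \<in> S"
  then obtain F' G' where d: "(F has_derivative F') (at z)" "(G has_derivative G') (at z)"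
    "\<And>c v. F' (c *s v) = c * F' v" "\<And>c v. G' (c *s v) = c * G' v"
    using assms unfolding holomorphic_in_def by metis
  show "\<exists>H. ((\<lambda>z. F z + G z) has_derivative H) (at z) \<and> (\<forall>c v. H (c *s v) = c * H v)"
    using has_derivative_add[OF d(1,2)] d(3,4)
    by (intro exI[of _ "\<lambda>v. F' v + G' v"]) (simp add: distrib_left)
qed

lemma holomorphic_in_mult:
  assumes "holomorphic_in S F" "holomorphic_in S G"
  shows "holomorphic_in S (\<lambda>z. F z * G z)"
  unfolding holomorphic_in_def
proof
  fix z assume "z \<in> S"
  then obtain F' G' where d: "(F has_derivative F') (at z)" "(G has_derivative G') (at z)"
    "\<And>c v. F' (c *s v) = c * F' v" "\<And>c v. G' (c *s v) = c * G' v"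
    using assms unfolding holomorphic_in_def by metis
  show "\<exists>H. ((\<lambda>z. F z * G z) has_derivative H) (at z) \<and> (\<forall>c v. H (c *s v) = c * H v)"
    using has_derivative_mult[OF d(1,2)] d(3,4)
    by (intro exI[of _ "\<lambda>v. F z * G' v + F' v * G z"]) (simp add: algebra_simps)
qed

lemma hol_mono: "g \<in> hol X A U \<Longrightarrow> V \<subseteq> U \<Longrightarrow> g \<in> hol X A V"
  unfolding hol_def by (auto intro: holomorphic_in_mono[OF _ image_mono[OF Int_mono[OF _ subset_refl]]])

lemma hol_const: "(\<lambda>_. c) \<in> hol X A U"
  by (auto simp: hol_def o_def holomorphic_in_const)

lemma hol_add: "g \<in> hol X A U \<Longrightarrow> h \<in> hol X A U \<Longrightarrow> (\<lambda>x. g x + h x) \<in> hol X A U"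
  by (auto simp: hol_def o_def intro: holomorphic_in_add)

lemma hol_mult: "g \<in> hol X A U \<Longrightarrow> h \<in> hol X A U \<Longrightarrow> (\<lambda>x. g x * h x) \<in> hol X A U"
  by (auto simp: hol_def o_def intro: holomorphic_in_mult)

lemma germ_eq_iff: "germ X p g = germ X p h \<longleftrightarrow> eventually (\<lambda>x. g x = h x) (nhdsin X p)"
proof
  assume "germ X p g = germ X p h"
  moreover have "g \<in> germ X p g" by (simp add: germ_def)
  ultimately show "eventually (\<lambda>x. g x = h x) (nhdsin X p)" by (simp add: germ_def)
next
  assume gh: "eventually (\<lambda>x. g x = h x) (nhdsin X p)"
  show "germ X p g = germ X p h"
    unfolding germ_def
  proof (intro Collect_cong iffI)
    fix k assume "eventually (\<lambda>x. k x = g x) (nhdsin X p)"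
    with gh show "eventually (\<lambda>x. k x = h x) (nhdsin X p)" by eventually_elim simp
  next
    fix k assume "eventually (\<lambda>x. k x = h x) (nhdsin X p)"
    with gh show "eventually (\<lambda>x. k x = g x) (nhdsin X p)" by eventually_elim simp
  qed
qed

lemma germ_mult:
  "germ X p g \<otimes>\<^bsub>O_stalk X A p\<^esub> germ X p h = germ X p (\<lambda>x. g x * h x)"
proof -
  have "k \<in> germ X p (\<lambda>x. g x * h x)"
    if "g' \<in> germ X p g" "h' \<in> germ X p h" "eventually (\<lambda>x. k x = g' x * h' x) (nhdsin X p)" for k g' h'
    using that unfolding germ_def mem_Collect_eq by eventually_elim simp
  moreover have "\<exists>g'\<in>germ X p g. \<exists>h'\<in>germ X p h. eventually (\<lambda>x. k x = g' x * h' x) (nhdsin X p)"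
    if "k \<in> germ X p (\<lambda>x. g x * h x)" for k
    using that by (intro bexI[of _ g] bexI[of _ h]) (simp_all add: germ_def)
  ultimately show ?thesis by (simp add: O_stalk_def) blast
qed

lemma germ_add:
  "germ X p g \<oplus>\<^bsub>O_stalk X A p\<^esub> germ X p h = germ X p (\<lambda>x. g x + h x)"
proof -
  have "k \<in> germ X p (\<lambda>x. g x + h x)"
    if "g' \<in> germ X p g" "h' \<in> germ X p h" "eventually (\<lambda>x. k x = g' x + h' x) (nhdsin X p)" for k g' h'
    using that unfolding germ_def mem_Collect_eq by eventually_elim simp
  moreover have "\<exists>g'\<in>germ X p g. \<exists>h'\<in>germ X p h. eventually (\<lambda>x. k x = g' x + h' x) (nhdsin X p)"
    if "k \<in> germ X p (\<lambda>x. g x + h x)" for k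
    using that by (intro bexI[of _ g] bexI[of _ h]) (simp_all add: germ_def)
  ultimately show ?thesis by (simp add: O_stalk_def) blast
qed

lemma germ_zero: "\<zero>\<^bsub>O_stalk X A p\<^esub> = germ X p (\<lambda>_. 0)"
  and germ_one: "\<one>\<^bsub>O_stalk X A p\<^esub> = germ X p (\<lambda>_. 1)"
  by (simp_all add: O_stalk_def)

lemma germ_in_stalk: "openin X U \<Longrightarrow> p \<in> U \<Longrightarrow> g \<in> hol X A U \<Longrightarrow> germ X p g \<in> carrier (O_stalk X A p)"
  by (auto simp: O_stalk_def)

lemma stalk_cases:
  assumes "a \<in> carrier (O_stalk X A p)"
  obtains U g where "openin X U" "p \<in> U" "g \<in> hol X A U" "a = germ X p g"
  using assms by (auto simp: O_stalk_def)

lemma stalk_cases2: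
  assumes "a \<in> carrier (O_stalk X A p)" "b \<in> carrier (O_stalk X A p)"
  obtains U g h where "openin X U" "p \<in> U" "g \<in> hol X A U" "h \<in> hol X A U"
    "a = germ X p g" "b = germ X p h"
proof -
  obtain U g where U: "openin X U" "p \<in> U" "g \<in> hol X A U" "a = germ X p g"
    using stalk_cases[OF assms(1)] .
  obtain V h where V: "openin X V" "p \<in> V" "h \<in> hol X A V" "b = germ X p h"
    using stalk_cases[OF assms(2)] .
  show thesis
    by (rule that[of "U \<inter> V" g h]) (use U V in \<open>auto intro: hol_mono\<close>)
qed

lemma germ_const_in_stalk:
  "p \<in> topspace X \<Longrightarrow> germ X p (\<lambda>_. c) \<in> carrier (O_stalk X A p)"
  by (rule germ_in_stalk[of X "topspace X"]) (auto simp: hol_const)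

lemma cring_O_stalk:
  assumes p: "p \<in> topspace X"
  shows "cring (O_stalk X A p)" (is "cring ?O")
proof -
  have add_closed: "a \<oplus>\<^bsub>?O\<^esub> b \<in> carrier ?O" if "a \<in> carrier ?O" "b \<in> carrier ?O" for a b
    by (rule stalk_cases2[OF that]) (simp add: germ_add germ_in_stalk hol_add)
  have mult_closed: "a \<otimes>\<^bsub>?O\<^esub> b \<in> carrier ?O" if "a \<in> carrier ?O" "b \<in> carrier ?O" for a b
    by (rule stalk_cases2[OF that]) (simp add: germ_mult germ_in_stalk hol_mult)
  have neg: "\<exists>b\<in>carrier ?O. b \<oplus>\<^bsub>?O\<^esub> a = \<zero>\<^bsub>?O\<^esub>" if a: "a \<in> carrier ?O" for a
  proof -
    obtain U g where U: "openin X U" "p \<in> U" "g \<in> hol X A U" "a = germ X p g"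
      using stalk_cases[OF a] .
    have "germ X p (\<lambda>x. - 1 * g x) \<in> carrier ?O"
      by (intro germ_in_stalk[OF U(1,2)] hol_mult hol_const U)
    then show ?thesis
      by (rule rev_bexI) (simp add: U germ_add germ_zero)
  qed
  have stalk_rep: "\<exists>g. a = germ X p g" if "a \<in> carrier ?O" for a
    using stalk_cases[OF that] by blast
  show ?thesis
  proof (rule cringI)
    show "abelian_group ?O"
    proof (rule abelian_groupI)
      fix a b c assume "a \<in> carrier ?O" "b \<in> carrier ?O" "c \<in> carrier ?O"
      then obtain g h k where "a = germ X p g" "b = germ X p h" "c = germ X p k"
        by (meson stalk_rep)
      then show "a \<oplus>\<^bsub>?O\<^esub> b \<oplus>\<^bsub>?O\<^esub> c = a \<oplus>\<^bsub>?O\<^esub> (b \<oplus>\<^bsub>?O\<^esub> c)"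
        by (simp add: germ_add add.assoc)
    next
      fix a b assume "a \<in> carrier ?O" "b \<in> carrier ?O"
      then obtain g h where "a = germ X p g" "b = germ X p h"
        by (meson stalk_rep)
      then show "a \<oplus>\<^bsub>?O\<^esub> b = b \<oplus>\<^bsub>?O\<^esub> a"
        by (simp add: germ_add add.commute)
    next
      fix a assume "a \<in> carrier ?O"
      then obtain g where "a = germ X p g" by (meson stalk_rep)
      then show "\<zero>\<^bsub>?O\<^esub> \<oplus>\<^bsub>?O\<^esub> a = a" by (simp add: germ_zero germ_add)
    qed (use add_closed neg germ_const_in_stalk[OF p] in \<open>auto simp: germ_zero\<close>)
    show "comm_monoid ?O"
    proof (rule comm_monoidI)
      fix a b c assume "a \<in> carrier ?O" "b \<in> carrier ?O" "c \<in> carrier ?O"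
      then obtain g h k where "a = germ X p g" "b = germ X p h" "c = germ X p k"
        by (meson stalk_rep)
      then show "a \<otimes>\<^bsub>?O\<^esub> b \<otimes>\<^bsub>?O\<^esub> c = a \<otimes>\<^bsub>?O\<^esub> (b \<otimes>\<^bsub>?O\<^esub> c)"
        by (simp add: germ_mult mult.assoc)
    next
      fix a b assume "a \<in> carrier ?O" "b \<in> carrier ?O"
      then obtain g h where "a = germ X p g" "b = germ X p h"
        by (meson stalk_rep)
      then show "a \<otimes>\<^bsub>?O\<^esub> b = b \<otimes>\<^bsub>?O\<^esub> a"
        by (simp add: germ_mult mult.commute)
    next
      fix a assume "a \<in> carrier ?O"
      then obtain g where "a = germ X p g" by (meson stalk_rep)
      then show "\<one>\<^bsub>?O\<^esub> \<otimes>\<^bsub>?O\<^esub> a = a" by (simp add: germ_one germ_mult)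
    qed (use mult_closed germ_const_in_stalk[OF p] in \<open>auto simp: germ_one\<close>)
    fix a b c assume "a \<in> carrier ?O" "b \<in> carrier ?O" "c \<in> carrier ?O"
    then obtain g h k where "a = germ X p g" "b = germ X p h" "c = germ X p k"
      by (meson stalk_rep)
    then show "(a \<oplus>\<^bsub>?O\<^esub> b) \<otimes>\<^bsub>?O\<^esub> c = a \<otimes>\<^bsub>?O\<^esub> c \<oplus>\<^bsub>?O\<^esub> b \<otimes>\<^bsub>?O\<^esub> c"
      by (simp add: germ_add germ_mult distrib_right)
  qed
qed

lemma mem_End_stalk_iff:
  "P \<in> carrier (End_stalk X A p) \<longleftrightarrow> P \<in> carrier (O_stalk X A p) \<rightarrow>\<^sub>E carrier (O_stalk X A p) \<and>
    (\<forall>a\<in>carrier (O_stalk X A p). \<forall>b\<in>carrier (O_stalk X A p).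
      P (a \<oplus>\<^bsub>O_stalk X A p\<^esub> b) = P a \<oplus>\<^bsub>O_stalk X A p\<^esub> P b) \<and>
    (\<forall>c. \<forall>a\<in>carrier (O_stalk X A p).
      P (germ X p (\<lambda>_. c) \<otimes>\<^bsub>O_stalk X A p\<^esub> a) = germ X p (\<lambda>_. c) \<otimes>\<^bsub>O_stalk X A p\<^esub> P a)"
  by (simp add: End_stalk_def Let_def)

lemma End_stalk_ops:
  "P \<otimes>\<^bsub>End_stalk X A p\<^esub> Q = compose (carrier (O_stalk X A p)) P Q"
  "P \<oplus>\<^bsub>End_stalk X A p\<^esub> Q = (\<lambda>a\<in>carrier (O_stalk X A p). P a \<oplus>\<^bsub>O_stalk X A p\<^esub> Q a)"
  "\<one>\<^bsub>End_stalk X A p\<^esub> = (\<lambda>a\<in>carrier (O_stalk X A p). a)"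
  "\<zero>\<^bsub>End_stalk X A p\<^esub> = (\<lambda>a\<in>carrier (O_stalk X A p). \<zero>\<^bsub>O_stalk X A p\<^esub>)"
  by (simp_all add: End_stalk_def Let_def)

lemma End_stalk_app:
  assumes "P \<in> carrier (End_stalk X A p)" "a \<in> carrier (O_stalk X A p)"
  shows "P a \<in> carrier (O_stalk X A p)"
  using assms by (auto simp: mem_End_stalk_iff)

lemma End_stalk_eqI:
  assumes "P \<in> carrier (End_stalk X A p)" "Q \<in> carrier (End_stalk X A p)"
    and "\<And>a. a \<in> carrier (O_stalk X A p) \<Longrightarrow> P a = Q a"
  shows "P = Q"
  using assms by (intro PiE_ext[of P "carrier (O_stalk X A p)" "\<lambda>_. carrier (O_stalk X A p)" Q])
    (auto simp: mem_End_stalk_iff)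

lemma ring_End_stalk:
  assumes p: "p \<in> topspace X"
  shows "ring (End_stalk X A p)" (is "ring ?E")
proof -
  let ?O = "O_stalk X A p"
  interpret O: cring ?O by (rule cring_O_stalk[OF p])
  note const = germ_const_in_stalk[OF p, of _ A]
  note app = End_stalk_app[of _ X A p]
  have add_closed: "P \<oplus>\<^bsub>?E\<^esub> Q \<in> carrier ?E" if "P \<in> carrier ?E" "Q \<in> carrier ?E" for P Q
    using that app[OF that(1)] app[OF that(2)] const
    by (simp add: mem_End_stalk_iff End_stalk_ops O.a_ac O.r_distr)
  have mult_closed: "P \<otimes>\<^bsub>?E\<^esub> Q \<in> carrier ?E" if "P \<in> carrier ?E" "Q \<in> carrier ?E" for P Q
    using that app[OF that(1)] app[OF that(2)] const
    by (simp add: mem_End_stalk_iff End_stalk_ops compose_def)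
  have one: "\<one>\<^bsub>?E\<^esub> \<in> carrier ?E" and zero: "\<zero>\<^bsub>?E\<^esub> \<in> carrier ?E"
    using const by (simp_all add: mem_End_stalk_iff End_stalk_ops)
  have neg: "\<exists>Q\<in>carrier ?E. Q \<oplus>\<^bsub>?E\<^esub> P = \<zero>\<^bsub>?E\<^esub>" if "P \<in> carrier ?E" for P
  proof (rule bexI)
    let ?Q = "\<lambda>a\<in>carrier ?O. \<ominus>\<^bsub>?O\<^esub> (P a)"
    show Q: "?Q \<in> carrier ?E"
      using that app[OF that] const
      by (simp add: mem_End_stalk_iff O.minus_add O.r_minus)
    show "?Q \<oplus>\<^bsub>?E\<^esub> P = \<zero>\<^bsub>?E\<^esub>"
      by (rule End_stalk_eqI[OF add_closed[OF Q that] zero])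
        (simp add: End_stalk_ops O.l_neg app[OF that])
  qed
  show ?thesis
  proof (rule ringI)
    show "abelian_group ?E"
    proof (rule abelian_groupI)
      fix P Q T assume PQT: "P \<in> carrier ?E" "Q \<in> carrier ?E" "T \<in> carrier ?E"
      then show "P \<oplus>\<^bsub>?E\<^esub> Q \<oplus>\<^bsub>?E\<^esub> T = P \<oplus>\<^bsub>?E\<^esub> (Q \<oplus>\<^bsub>?E\<^esub> T)"
        by (intro End_stalk_eqI[OF add_closed[OF add_closed] add_closed[OF _ add_closed]])
          (simp_all add: End_stalk_ops O.a_assoc app)
    next
      fix P Q assume PQ: "P \<in> carrier ?E" "Q \<in> carrier ?E"
      then show "P \<oplus>\<^bsub>?E\<^esub> Q = Q \<oplus>\<^bsub>?E\<^esub> P"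
        by (intro End_stalk_eqI[OF add_closed add_closed])
          (simp_all add: End_stalk_ops O.a_comm app)
    next
      fix P assume P: "P \<in> carrier ?E"
      then show "\<zero>\<^bsub>?E\<^esub> \<oplus>\<^bsub>?E\<^esub> P = P"
        by (intro End_stalk_eqI[OF add_closed[OF zero]]) (simp_all add: End_stalk_ops app)
    qed (use add_closed zero neg in auto)
    show "monoid ?E"
    proof (rule monoidI)
      fix P Q T assume PQT: "P \<in> carrier ?E" "Q \<in> carrier ?E" "T \<in> carrier ?E"
      then show "P \<otimes>\<^bsub>?E\<^esub> Q \<otimes>\<^bsub>?E\<^esub> T = P \<otimes>\<^bsub>?E\<^esub> (Q \<otimes>\<^bsub>?E\<^esub> T)"
        by (intro End_stalk_eqI[OF mult_closed[OF mult_closed] mult_closed[OF _ mult_closed]])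
          (simp_all add: End_stalk_ops compose_def app)
    next
      fix P assume P: "P \<in> carrier ?E"
      then show "\<one>\<^bsub>?E\<^esub> \<otimes>\<^bsub>?E\<^esub> P = P" "P \<otimes>\<^bsub>?E\<^esub> \<one>\<^bsub>?E\<^esub> = P"
        by (intro End_stalk_eqI[OF mult_closed[OF one]] End_stalk_eqI[OF mult_closed[OF _ one]];
          simp add: End_stalk_ops compose_def app)+
    qed (use mult_closed one in auto)
    fix P Q T assume PQT: "P \<in> carrier ?E" "Q \<in> carrier ?E" "T \<in> carrier ?E"
    show "(P \<oplus>\<^bsub>?E\<^esub> Q) \<otimes>\<^bsub>?E\<^esub> T = P \<otimes>\<^bsub>?E\<^esub> T \<oplus>\<^bsub>?E\<^esub> Q \<otimes>\<^bsub>?E\<^esub> T"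
      by (rule End_stalk_eqI[OF mult_closed[OF add_closed[OF PQT(1,2)] PQT(3)]
            add_closed[OF mult_closed[OF PQT(1,3)] mult_closed[OF PQT(2,3)]]])
        (simp add: End_stalk_ops compose_def app PQT)
    have "T (P a \<oplus>\<^bsub>?O\<^esub> Q a) = T (P a) \<oplus>\<^bsub>?O\<^esub> T (Q a)" if "a \<in> carrier ?O" for a
      using PQT(3) app[OF PQT(1) that] app[OF PQT(2) that] by (simp add: mem_End_stalk_iff)
    then show "T \<otimes>\<^bsub>?E\<^esub> (P \<oplus>\<^bsub>?E\<^esub> Q) = T \<otimes>\<^bsub>?E\<^esub> P \<oplus>\<^bsub>?E\<^esub> T \<otimes>\<^bsub>?E\<^esub> Q"
      by (intro End_stalk_eqI[OF mult_closed[OF PQT(3) add_closed[OF PQT(1,2)]]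
            add_closed[OF mult_closed[OF PQT(3,1)] mult_closed[OF PQT(3,2)]]])
        (simp add: End_stalk_ops compose_def app PQT)
  qed
qed


section \<open>Stalks of vector fields and differential operators\<close>

lemma mult_op_app:
  "b \<in> carrier (O_stalk X A p) \<Longrightarrow> mult_op X A p a b = a \<otimes>\<^bsub>O_stalk X A p\<^esub> b"
  by (simp add: mult_op_def)

lemma mult_op_closed:
  assumes "p \<in> topspace X" "a \<in> carrier (O_stalk X A p)"
  shows "mult_op X A p a \<in> carrier (End_stalk X A p)"
proof -
  interpret O: cring "O_stalk X A p" by (rule cring_O_stalk[OF assms(1)])
  show ?thesis
    using assms(2) germ_const_in_stalk[OF assms(1), of _ A]
    by (auto simp: mem_End_stalk_iff mult_op_def O.r_distr O.m_lcomm)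
qed

lemma End_stalk_apply:
  assumes "b \<in> carrier (O_stalk X A p)"
  shows "(P \<otimes>\<^bsub>End_stalk X A p\<^esub> Q) b = P (Q b)"
    and "(P \<oplus>\<^bsub>End_stalk X A p\<^esub> Q) b = P b \<oplus>\<^bsub>O_stalk X A p\<^esub> Q b"
  using assms by (simp_all add: End_stalk_ops compose_def)

lemma mult_op_add:
  assumes p: "p \<in> topspace X" and ab: "a \<in> carrier (O_stalk X A p)" "b \<in> carrier (O_stalk X A p)"
  shows "mult_op X A p (a \<oplus>\<^bsub>O_stalk X A p\<^esub> b) = mult_op X A p a \<oplus>\<^bsub>End_stalk X A p\<^esub> mult_op X A p b"
proof -
  interpret O: cring "O_stalk X A p" by (rule cring_O_stalk[OF p])
  interpret E: ring "End_stalk X A p" by (rule ring_End_stalk[OF p])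
  show ?thesis
    by (rule End_stalk_eqI[OF mult_op_closed[OF p] E.a_closed[OF mult_op_closed mult_op_closed]])
      (use p ab in \<open>simp_all add: End_stalk_apply mult_op_app O.l_distr\<close>)
qed

lemma mult_op_mult:
  assumes p: "p \<in> topspace X" and ab: "a \<in> carrier (O_stalk X A p)" "b \<in> carrier (O_stalk X A p)"
  shows "mult_op X A p (a \<otimes>\<^bsub>O_stalk X A p\<^esub> b) = mult_op X A p a \<otimes>\<^bsub>End_stalk X A p\<^esub> mult_op X A p b"
proof -
  interpret O: cring "O_stalk X A p" by (rule cring_O_stalk[OF p])
  interpret E: ring "End_stalk X A p" by (rule ring_End_stalk[OF p])
  show ?thesis
    by (rule End_stalk_eqI[OF mult_op_closed[OF p] E.m_closed[OF mult_op_closed mult_op_closed]])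
      (use p ab in \<open>simp_all add: End_stalk_apply mult_op_app O.m_assoc\<close>)
qed

lemma derivation_at_closed: "derivation_at X A p \<delta> \<Longrightarrow> \<delta> \<in> carrier (End_stalk X A p)"
  by (simp add: derivation_at_def)

lemma derivation_at_Leibniz:
  assumes "derivation_at X A p \<delta>" "b \<in> carrier (O_stalk X A p)" "c \<in> carrier (O_stalk X A p)"
  shows "\<delta> (b \<otimes>\<^bsub>O_stalk X A p\<^esub> c) =
      \<delta> b \<otimes>\<^bsub>O_stalk X A p\<^esub> c \<oplus>\<^bsub>O_stalk X A p\<^esub> b \<otimes>\<^bsub>O_stalk X A p\<^esub> \<delta> c"
  using assms by (simp add: derivation_at_def Let_def)

lemma derivation_at_add:
  assumes p: "p \<in> topspace X" and d: "derivation_at X A p \<delta>" "derivation_at X A p \<eta>"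
  shows "derivation_at X A p (\<delta> \<oplus>\<^bsub>End_stalk X A p\<^esub> \<eta>)"
proof -
  interpret O: cring "O_stalk X A p" by (rule cring_O_stalk[OF p])
  interpret E: ring "End_stalk X A p" by (rule ring_End_stalk[OF p])
  note E = derivation_at_closed[OF d(1)] derivation_at_closed[OF d(2)]
  show ?thesis
    unfolding derivation_at_def Let_def
    using E End_stalk_app[OF E(1)] End_stalk_app[OF E(2)]
    by (simp add: End_stalk_apply derivation_at_Leibniz[OF d(1)] derivation_at_Leibniz[OF d(2)]
        O.l_distr O.r_distr O.a_ac)
qed

lemma derivation_at_mult:
  assumes p: "p \<in> topspace X" and a: "a \<in> carrier (O_stalk X A p)" and d: "derivation_at X A p \<delta>"
  shows "derivation_at X A p (mult_op X A p a \<otimes>\<^bsub>End_stalk X A p\<^esub> \<delta>)"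
proof -
  interpret O: cring "O_stalk X A p" by (rule cring_O_stalk[OF p])
  interpret E: ring "End_stalk X A p" by (rule ring_End_stalk[OF p])
  note E = derivation_at_closed[OF d]
  show ?thesis
    unfolding derivation_at_def Let_def
    using E mult_op_closed[OF p a] End_stalk_app[OF E] a
    by (simp add: End_stalk_apply mult_op_app derivation_at_Leibniz[OF d] O.r_distr O.m_ac)
qed

lemma vector_field_subset:
  "vector_field X A U \<delta> \<Longrightarrow> V \<subseteq> U \<Longrightarrow> vector_field X A V \<delta>"
  unfolding vector_field_def by (meson subset_iff subset_trans)

lemma vector_field_image:
  assumes "vector_field X A U \<delta>" "openin X V" "V \<subseteq> U" "g \<in> hol X A V"
  shows "\<exists>h\<in>hol X A V. \<forall>q\<in>V. \<delta> q (germ X q g) = germ X q h"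
  using assms by (simp add: vector_field_def)

lemma vector_field_add:
  assumes U: "openin X U" and d: "vector_field X A U \<delta>" "vector_field X A U \<eta>"
  shows "vector_field X A U (\<lambda>q. \<delta> q \<oplus>\<^bsub>End_stalk X A q\<^esub> \<eta> q)"
proof -
  have "\<exists>h\<in>hol X A V. \<forall>q\<in>V. (\<delta> q \<oplus>\<^bsub>End_stalk X A q\<^esub> \<eta> q) (germ X q g) = germ X q h"
    if V: "openin X V" "V \<subseteq> U" "g \<in> hol X A V" for V g
  proof -
    obtain h1 h2 where h: "h1 \<in> hol X A V" "\<forall>q\<in>V. \<delta> q (germ X q g) = germ X q h1"
      "h2 \<in> hol X A V" "\<forall>q\<in>V. \<eta> q (germ X q g) = germ X q h2"
      using vector_field_image[OF d(1) V] vector_field_image[OF d(2) V] by blast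
    show ?thesis
      using h V by (intro bexI[OF _ hol_add[OF h(1,3)]])
        (simp add: End_stalk_apply germ_in_stalk germ_add)
  qed
  moreover have "derivation_at X A q (\<delta> q \<oplus>\<^bsub>End_stalk X A q\<^esub> \<eta> q)" if "q \<in> U" for q
    using that d openin_subset[OF U]
    by (intro derivation_at_add) (auto simp: vector_field_def)
  ultimately show ?thesis by (auto simp: vector_field_def)
qed

lemma vector_field_mult:
  assumes U: "openin X U" and g: "g \<in> hol X A U" and d: "vector_field X A U \<delta>"
  shows "vector_field X A U (\<lambda>q. mult_op X A q (germ X q g) \<otimes>\<^bsub>End_stalk X A q\<^esub> \<delta> q)"
proof -
  have "\<exists>h\<in>hol X A V. \<forall>q\<in>V.
      (mult_op X A q (germ X q g) \<otimes>\<^bsub>End_stalk X A q\<^esub> \<delta> q) (germ X q k) = germ X q h"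
    if V: "openin X V" "V \<subseteq> U" "k \<in> hol X A V" for V k
  proof -
    obtain h where h: "h \<in> hol X A V" "\<forall>q\<in>V. \<delta> q (germ X q k) = germ X q h"
      using vector_field_image[OF d V] by blast
    show ?thesis
      using h V by (intro bexI[OF _ hol_mult[OF hol_mono[OF g V(2)] h(1)]])
        (simp add: End_stalk_apply mult_op_app germ_in_stalk germ_mult)
  qed
  moreover have "derivation_at X A q (mult_op X A q (germ X q g) \<otimes>\<^bsub>End_stalk X A q\<^esub> \<delta> q)"
    if "q \<in> U" for q
    using that d openin_subset[OF U] germ_in_stalk[OF U that g]
    by (intro derivation_at_mult) (auto simp: vector_field_def)
  ultimately show ?thesis by (auto simp: vector_field_def)
qed

lemma Der_stalk_subset: "Der_stalk X A p \<subseteq> carrier (End_stalk X A p)"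
  by (auto simp: Der_stalk_def vector_field_def derivation_at_def)

lemma Der_stalk_add:
  assumes "\<delta> \<in> Der_stalk X A p" "\<eta> \<in> Der_stalk X A p"
  shows "\<delta> \<oplus>\<^bsub>End_stalk X A p\<^esub> \<eta> \<in> Der_stalk X A p"
proof -
  obtain d U where d: "openin X U" "p \<in> U" "vector_field X A U d" "\<delta> = d p"
    using assms(1) by (auto simp: Der_stalk_def)
  obtain e V where e: "openin X V" "p \<in> V" "vector_field X A V e" "\<eta> = e p"
    using assms(2) by (auto simp: Der_stalk_def)
  have "vector_field X A (U \<inter> V) (\<lambda>q. d q \<oplus>\<^bsub>End_stalk X A q\<^esub> e q)"
    using d e by (intro vector_field_add) (auto intro: vector_field_subset)
  with d e show ?thesis
    by (auto simp: Der_stalk_def intro!: exI[of _ "\<lambda>q. d q \<oplus>\<^bsub>End_stalk X A q\<^esub> e q"] exI[of _ "U \<inter> V"])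
qed

lemma Der_stalk_mult:
  assumes "a \<in> carrier (O_stalk X A p)" "\<delta> \<in> Der_stalk X A p"
  shows "mult_op X A p a \<otimes>\<^bsub>End_stalk X A p\<^esub> \<delta> \<in> Der_stalk X A p"
proof -
  obtain V g where g: "openin X V" "p \<in> V" "g \<in> hol X A V" "a = germ X p g"
    using stalk_cases[OF assms(1)] .
  obtain d U where d: "openin X U" "p \<in> U" "vector_field X A U d" "\<delta> = d p"
    using assms(2) by (auto simp: Der_stalk_def)
  let ?e = "\<lambda>q. mult_op X A q (germ X q g) \<otimes>\<^bsub>End_stalk X A q\<^esub> d q"
  have "vector_field X A (U \<inter> V) ?e"
    using d g by (intro vector_field_mult) (auto intro: vector_field_subset hol_mono)
  with d g show ?thesis
    by (auto simp: Der_stalk_def intro!: exI[of _ ?e] exI[of _ "U \<inter> V"])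
qed

lemma D_stalk_ops [simp]:
  "P \<otimes>\<^bsub>D_stalk X A p\<^esub> Q = P \<otimes>\<^bsub>End_stalk X A p\<^esub> Q"
  "P \<oplus>\<^bsub>D_stalk X A p\<^esub> Q = P \<oplus>\<^bsub>End_stalk X A p\<^esub> Q"
  by (simp_all add: D_stalk_def)

lemma ring_D_stalk:
  assumes p: "p \<in> topspace X" shows "ring (D_stalk X A p)"
  unfolding D_stalk_def
proof (rule ring.generate_ring_is_ring[OF ring_End_stalk[OF p]])
  show "mult_op X A p ` carrier (O_stalk X A p) \<union> Der_stalk X A p \<subseteq> carrier (End_stalk X A p)"
    by (intro Un_least image_subsetI mult_op_closed[OF p] Der_stalk_subset)
qed

lemma mult_op_in_D_stalk: "a \<in> carrier (O_stalk X A p) \<Longrightarrow> mult_op X A p a \<in> carrier (D_stalk X A p)"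
  by (auto simp: D_stalk_def intro: generate_ring.incl)

lemma Der_stalk_in_D_stalk: "\<delta> \<in> Der_stalk X A p \<Longrightarrow> \<delta> \<in> carrier (D_stalk X A p)"
  by (auto simp: D_stalk_def intro: generate_ring.incl)



section \<open>Logarithmic vector fields along a reduced equation\<close>

text \<open>
  Holomorphic functions are differentiable in a chart, hence continuous; charts have open domains and are
  homeomorphisms onto their images.
\<close>

lemma hol_nonzero_nhd:
  assumes X: "complex_manifold X A" and U: "openin X U" "q \<in> U" and g: "g \<in> hol X A U" "g q \<noteq> 0"
  shows "\<exists>W. openin X W \<and> q \<in> W \<and> (\<forall>x\<in>W. g x \<noteq> 0)"
proof -
  have "q \<in> topspace X" using U openin_subset by blast
  with X obtain V \<phi> where V: "(V, \<phi>) \<in> A" "q \<in> V"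
    unfolding complex_manifold_def by auto
  with X have open_V: "openin X V"
    and homeo: "homeomorphic_map (subtopology X V) (top_of_set (\<phi> ` V)) \<phi>"
    unfolding complex_manifold_def by auto
  have V_top: "topspace (subtopology X V) = V"
    using openin_subset[OF open_V] by auto
  have inj: "inj_on \<phi> V"
    using homeomorphic_imp_injective_map[OF homeo] unfolding V_top .
  have "holomorphic_in (\<phi> ` (U \<inter> V)) (g \<circ> inv_into V \<phi>)"
    using g(1) V(1) unfolding hol_def by auto
  then have "continuous (at (\<phi> q)) (g \<circ> inv_into V \<phi>)"
    using U(2) V(2) unfolding holomorphic_in_def by (blast intro: has_derivative_continuous)
  then have "(g \<circ> inv_into V \<phi>) \<midarrow>\<phi> q\<rightarrow> g q"
    using V(2) inj by (simp add: isCont_def inv_into_f_f)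
  moreover have "g (inv_into V \<phi> (\<phi> q)) \<noteq> 0"
    using g(2) V(2) inj by simp
  ultimately have "eventually (\<lambda>z. g (inv_into V \<phi> z) \<noteq> 0) (nhds (\<phi> q))"
    using tendsto_imp_eventually_ne[of "g \<circ> inv_into V \<phi>" "g q" "at (\<phi> q)" 0] g(2)
    by (auto simp: eventually_at_filter elim: eventually_mono)
  then obtain T where T: "open T" "\<phi> q \<in> T" "\<And>z. z \<in> T \<Longrightarrow> g (inv_into V \<phi> z) \<noteq> 0"
    unfolding eventually_nhds by blast
  have "openin (subtopology X V) {x \<in> V. \<phi> x \<in> \<phi> ` V \<inter> T}"
    using openin_continuous_map_preimage[OF homeomorphic_imp_continuous_map[OF homeo] openin_open_Int[OF T(1)]]
    unfolding V_top .
  then have "openin X {x \<in> V. \<phi> x \<in> \<phi> ` V \<inter> T}"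
    using openin_trans_full open_V by blast
  moreover have "g x \<noteq> 0" if "x \<in> V" "\<phi> x \<in> T" for x
    using T(3)[OF that(2)] that(1) inj by simp
  ultimately show ?thesis
    using V(2) T(2) by (intro exI[of _ "{x \<in> V. \<phi> x \<in> \<phi> ` V \<inter> T}"]) auto
qed

text \<open>
  The hypersurface has empty interior, because its local equations \<open>h\<close> have non-zero germs at every point.
  If \<open>\<alpha> f = 0\<close> but \<open>\<alpha>\<close> were non-zero at some point nearby, then \<open>\<alpha>\<close> would be non-zero on an open set, on which
  \<open>f\<close> vanishes; that set would lie in \<open>D\<close>.
\<close>

lemma germ_f_regular:
  assumes X: "complex_manifold X A" and D: "hypersurface X A D" "D = {x \<in> topspace X. f x = 0}"
    and p: "p \<in> topspace X" and \<alpha>: "\<alpha> \<in> carrier (O_stalk X A p)"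
    and zero: "\<alpha> \<otimes>\<^bsub>O_stalk X A p\<^esub> germ X p f = \<zero>\<^bsub>O_stalk X A p\<^esub>"
  shows "\<alpha> = \<zero>\<^bsub>O_stalk X A p\<^esub>"
proof -
  obtain U g where U: "openin X U" "p \<in> U" "g \<in> hol X A U" "\<alpha> = germ X p g"
    using stalk_cases[OF \<alpha>] .
  obtain W h where W: "openin X W" "p \<in> W" "D \<inter> W = {x \<in> W. h x = 0}"
    and h: "\<And>q. q \<in> W \<Longrightarrow> germ X q h \<noteq> \<zero>\<^bsub>O_stalk X A q\<^esub>"
    using D(1) p unfolding hypersurface_def by metis
  have "eventually (\<lambda>x. g x * f x = 0) (nhdsin X p)"
    using zero by (simp add: U(4) germ_mult germ_zero germ_eq_iff)
  then obtain N where N: "openin X N" "p \<in> N" "\<And>x. x \<in> N \<Longrightarrow> g x * f x = 0"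
    using p unfolding eventually_nhdsin by auto
  have g0: "g x = 0" if x: "x \<in> U \<inter> W \<inter> N" for x
  proof (rule ccontr)
    assume gx: "g x \<noteq> 0"
    have "x \<in> U" using x by blast
    from hol_nonzero_nhd[OF X U(1) this U(3) gx]
    obtain T where T: "openin X T" "x \<in> T" "\<And>y. y \<in> T \<Longrightarrow> g y \<noteq> 0"
      by blast
    have "h y = 0" if y: "y \<in> T \<inter> (W \<inter> N)" for y
    proof -
      have "f y = 0" using y N(3)[of y] T(3)[of y] by auto
      moreover have "y \<in> topspace X" using y openin_subset[OF W(1)] by blast
      ultimately have "y \<in> D \<inter> W" using y by (simp add: D(2))
      then show ?thesis unfolding W(3) by simp
    qed
    then have "eventually (\<lambda>y. h y = 0) (nhdsin X x)"
      unfolding eventually_nhdsin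
      using T(1,2) W(1) N(1) x by (intro disjI2 exI[of _ "T \<inter> (W \<inter> N)"]) auto
    then show False using h[of x] x by (simp add: germ_zero germ_eq_iff)
  qed
  then show ?thesis
    unfolding U(4) germ_zero germ_eq_iff eventually_nhdsin
    using U(1,2) W(1,2) N(1,2) by (intro disjI2 exI[of _ "U \<inter> W \<inter> N"]) auto
qed

text \<open>
  Being logarithmic is required at all points of a neighbourhood, but it can be tested at the one point \<open>p\<close>:
  both sides of \<open>\<delta>(f) = \<alpha> f\<close> come from functions near \<open>p\<close>, so the equation spreads to a neighbourhood, and by
  the Leibniz rule it implies at each point that \<open>\<delta>\<close> preserves the ideal generated by \<open>f\<close>.
\<close>

lemma Der_log_stalk_eq:
  assumes f: "reduced_equation X A D f" and p: "p \<in> topspace X"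
  shows "Der_log_stalk X A D p =
    {\<delta> \<in> Der_stalk X A p. \<exists>\<alpha>\<in>carrier (O_stalk X A p).
      \<delta> (germ X p f) = \<alpha> \<otimes>\<^bsub>O_stalk X A p\<^esub> germ X p f}"
proof -
  have f_hol: "f \<in> hol X A (topspace X)"
    and ideal: "\<And>q. q \<in> topspace X \<Longrightarrow> ideal_stalk X A D q =
      {a \<otimes>\<^bsub>O_stalk X A q\<^esub> germ X q f | a. a \<in> carrier (O_stalk X A q)}"
    using f by (auto simp: reduced_equation_def cgenideal_def)
  have f_stalk: "germ X q f \<in> carrier (O_stalk X A q)" if "q \<in> topspace X" for q
    by (rule germ_in_stalk[OF openin_topspace that f_hol])
  show ?thesis
  proof (intro Set.set_eqI iffI)
    fix \<delta> assume "\<delta> \<in> Der_log_stalk X A D p"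
    then obtain d U where d: "openin X U" "p \<in> U" "vector_field X A U d" "\<delta> = d p"
      "d p ` ideal_stalk X A D p \<subseteq> ideal_stalk X A D p"
      by (auto simp: Der_log_stalk_def log_vector_field_def)
    interpret O: cring "O_stalk X A p" by (rule cring_O_stalk[OF p])
    have "\<one>\<^bsub>O_stalk X A p\<^esub> \<otimes>\<^bsub>O_stalk X A p\<^esub> germ X p f \<in> ideal_stalk X A D p"
      unfolding ideal[OF p] using O.one_closed by blast
    then have "\<delta> (germ X p f) \<in> ideal_stalk X A D p"
      using d(4,5) f_stalk[OF p] by auto
    with d show "\<delta> \<in> {\<delta> \<in> Der_stalk X A p. \<exists>\<alpha>\<in>carrier (O_stalk X A p).
        \<delta> (germ X p f) = \<alpha> \<otimes>\<^bsub>O_stalk X A p\<^esub> germ X p f}"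
      unfolding ideal[OF p] by (auto simp: Der_stalk_def)
  next
    fix \<delta> assume "\<delta> \<in> {\<delta> \<in> Der_stalk X A p. \<exists>\<alpha>\<in>carrier (O_stalk X A p).
        \<delta> (germ X p f) = \<alpha> \<otimes>\<^bsub>O_stalk X A p\<^esub> germ X p f}"
    then obtain d U \<alpha> where d: "openin X U" "p \<in> U" "vector_field X A U d" "\<delta> = d p"
      and \<alpha>: "\<alpha> \<in> carrier (O_stalk X A p)" "d p (germ X p f) = \<alpha> \<otimes>\<^bsub>O_stalk X A p\<^esub> germ X p f"
      by (auto simp: Der_stalk_def)
    have U_top: "U \<subseteq> topspace X" by (rule openin_subset[OF d(1)])
    obtain V g where g: "openin X V" "p \<in> V" "g \<in> hol X A V" "\<alpha> = germ X p g"
      using stalk_cases[OF \<alpha>(1)] .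
    obtain h where h: "h \<in> hol X A U" "\<And>q. q \<in> U \<Longrightarrow> d q (germ X q f) = germ X q h"
      using vector_field_image[OF d(3,1) subset_refl hol_mono[OF f_hol U_top]] by blast
    have "eventually (\<lambda>x. h x = g x * f x) (nhdsin X p)"
      using \<alpha>(2) h(2)[OF d(2)] by (simp add: g(4) germ_mult germ_eq_iff)
    then obtain N where N: "openin X N" "p \<in> N" "\<And>x. x \<in> N \<Longrightarrow> h x = g x * f x"
      using p unfolding eventually_nhdsin by auto
    \<comment> \<open>On this neighbourhood the equation \<open>\<delta>(f) = \<alpha> f\<close> holds at every point.\<close>
    let ?W = "U \<inter> V \<inter> N"
    have W: "openin X ?W" "p \<in> ?W" using d g N by auto
    have "d q ` ideal_stalk X A D q \<subseteq> ideal_stalk X A D q" if q: "q \<in> ?W" for q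
    proof -
      have q_top: "q \<in> topspace X" using q U_top by blast
      interpret O: cring "O_stalk X A q" by (rule cring_O_stalk[OF q_top])
      have g_stalk: "germ X q g \<in> carrier (O_stalk X A q)"
        using q g by (intro germ_in_stalk[of X V]) auto
      have der: "derivation_at X A q (d q)" using d(3) q by (auto simp: vector_field_def)
      have "germ X q h = germ X q g \<otimes>\<^bsub>O_stalk X A q\<^esub> germ X q f"
        unfolding germ_mult germ_eq_iff eventually_nhdsin using N q by blast
      then have df: "d q (germ X q f) = germ X q g \<otimes>\<^bsub>O_stalk X A q\<^esub> germ X q f"
        using h(2) q by simp
      have *: "d q (a \<otimes>\<^bsub>O_stalk X A q\<^esub> germ X q f) =
          (d q a \<oplus>\<^bsub>O_stalk X A q\<^esub> a \<otimes>\<^bsub>O_stalk X A q\<^esub> germ X q g) \<otimes>\<^bsub>O_stalk X A q\<^esub> germ X q f"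
        "d q a \<oplus>\<^bsub>O_stalk X A q\<^esub> a \<otimes>\<^bsub>O_stalk X A q\<^esub> germ X q g \<in> carrier (O_stalk X A q)"
        if a: "a \<in> carrier (O_stalk X A q)" for a
      proof -
        have da: "d q a \<in> carrier (O_stalk X A q)"
          by (rule End_stalk_app[OF derivation_at_closed[OF der] a])
        show "d q a \<oplus>\<^bsub>O_stalk X A q\<^esub> a \<otimes>\<^bsub>O_stalk X A q\<^esub> germ X q g \<in> carrier (O_stalk X A q)"
          using a da g_stalk by simp
        have "d q (a \<otimes>\<^bsub>O_stalk X A q\<^esub> germ X q f) = d q a \<otimes>\<^bsub>O_stalk X A q\<^esub> germ X q f
            \<oplus>\<^bsub>O_stalk X A q\<^esub> a \<otimes>\<^bsub>O_stalk X A q\<^esub> d q (germ X q f)"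
          by (rule derivation_at_Leibniz[OF der a f_stalk[OF q_top]])
        then show "d q (a \<otimes>\<^bsub>O_stalk X A q\<^esub> germ X q f) =
          (d q a \<oplus>\<^bsub>O_stalk X A q\<^esub> a \<otimes>\<^bsub>O_stalk X A q\<^esub> germ X q g) \<otimes>\<^bsub>O_stalk X A q\<^esub> germ X q f"
          using a da g_stalk f_stalk[OF q_top] by (simp add: df O.l_distr O.m_assoc)
      qed
      show ?thesis
      proof (rule image_subsetI)
        fix b assume "b \<in> ideal_stalk X A D q"
        then obtain a where a: "a \<in> carrier (O_stalk X A q)" "b = a \<otimes>\<^bsub>O_stalk X A q\<^esub> germ X q f"
          unfolding ideal[OF q_top] by blast
        show "d q b \<in> ideal_stalk X A D q"
          unfolding ideal[OF q_top] a(2) using *[OF a(1)] by blast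
      qed
    qed
    then have "log_vector_field X A D ?W d"
      unfolding log_vector_field_def using vector_field_subset[OF d(3), of ?W] by blast
    with W d(4) show "\<delta> \<in> Der_log_stalk X A D p"
      unfolding Der_log_stalk_def by blast
  qed
qed


section \<open>The equivalence\<close>

lemma (in ring) diff_mult_add:
  assumes "a \<in> carrier R" "b \<in> carrier R" "c \<in> carrier R" "d \<in> carrier R" "s \<in> carrier R"
  shows "(a \<ominus> b \<otimes> s) \<oplus> (c \<ominus> d \<otimes> s) = (a \<oplus> c) \<ominus> (b \<oplus> d) \<otimes> s"
  using assms by (simp add: a_minus_def l_distr minus_add a_ac)

lemma (in ring) mult_diff_mult:
  assumes "a \<in> carrier R" "b \<in> carrier R" "c \<in> carrier R" "s \<in> carrier R"
  shows "a \<otimes> (b \<ominus> c \<otimes> s) = a \<otimes> b \<ominus> (a \<otimes> c) \<otimes> s"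
  using assms by (simp add: a_minus_def r_distr r_minus m_assoc)

text \<open>
  The elements of \<open>\<Theta>\<close> are parametrised by the pairs in \<open>\<Lambda>\<close>, on which addition and multiplication by functions
  are componentwise. Since \<open>f\<close> is not a zero divisor, \<open>\<delta>\<close> determines \<open>\<alpha>\<close>; therefore the constant coefficient
  \<open>\<delta>\<close> determines the element \<open>\<delta> - \<alpha> s\<close>.
\<close>

lemma s_deformation_stalk:
  assumes X: "complex_manifold X A" and D: "hypersurface X A D"
    and f: "reduced_equation X A D f" and p: "p \<in> topspace X"
  shows "s_deformation (Ds_stalk X A p) (D_stalk X A p) (mult_op X A p ` carrier (O_stalk X A p))
      (Theta_stalk X A f p) (\<lambda>q. coeff (Ds_stalk X A p) q 0) (const_s X A p) (s_elem X A p)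
      (\<lambda>q n. q (Suc n))"
    and "(\<lambda>q. coeff (Ds_stalk X A p) q 0) ` Theta_stalk X A f p = Der_log_stalk X A D p"
proof -
  let ?O = "O_stalk X A p" and ?E = "End_stalk X A p" and ?D = "D_stalk X A p" and ?S = "Ds_stalk X A p"
  let ?F = "germ X p f" and ?m = "mult_op X A p" and ?s = "s_elem X A p"
  define \<iota> where "\<iota> = const_s X A p"
  define \<theta> where "\<theta> = (\<lambda>\<delta> \<alpha>. \<iota> \<delta> \<ominus>\<^bsub>?S\<^esub> \<iota> (?m \<alpha>) \<otimes>\<^bsub>?S\<^esub> ?s)"
  define \<Lambda> where "\<Lambda> = {(\<delta>, \<alpha>). \<delta> \<in> Der_stalk X A p \<and> \<alpha> \<in> carrier ?O \<and> \<delta> ?F = \<alpha> \<otimes>\<^bsub>?O\<^esub> ?F}"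
  interpret O: cring ?O by (rule cring_O_stalk[OF p])
  interpret E: ring ?E by (rule ring_End_stalk[OF p])
  interpret D: UP_ring ?D ?S
    using ring_D_stalk[OF p] by (simp add: UP_ring_def)
  have fD: "D = {x \<in> topspace X. f x = 0}"
    using f unfolding reduced_equation_def by (elim conjE)
  have F: "?F \<in> carrier ?O"
    using f p by (intro germ_in_stalk[of X "topspace X"]) (auto simp: reduced_equation_def)
  have \<iota>_eq: "\<iota> = (\<lambda>b. monom ?S b 0)" by (simp add: \<iota>_def const_s_def fun_eq_iff)
  have \<iota>_hom: "\<iota> \<in> ring_hom ?D ?S" unfolding \<iota>_eq by (rule D.monom_0_hom)
  have \<iota>_closed: "\<iota> b \<in> carrier ?S" if "b \<in> carrier ?D" for b
    using ring_hom_closed[OF \<iota>_hom that] .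
  have s: "?s \<in> carrier ?S" by (simp add: s_elem_def)
  have Theta: "Theta_stalk X A f p = (\<lambda>(\<delta>, \<alpha>). \<theta> \<delta> \<alpha>) ` \<Lambda>"
    by (auto simp: Theta_stalk_def \<theta>_def \<iota>_def \<Lambda>_def)
  have ThetaI: "\<theta> \<delta> \<alpha> \<in> Theta_stalk X A f p" if "(\<delta>, \<alpha>) \<in> \<Lambda>" for \<delta> \<alpha>
    unfolding Theta by (rule image_eqI[OF _ that]) simp
  have Theta_cases: "\<exists>\<delta> \<alpha>. (\<delta>, \<alpha>) \<in> \<Lambda> \<and> x = \<theta> \<delta> \<alpha>" if "x \<in> Theta_stalk X A f p" for x
    using that unfolding Theta by auto
  have \<Lambda>D: "\<delta> \<in> carrier ?D" "?m \<alpha> \<in> carrier ?D" "\<delta> \<in> carrier ?E" "\<delta> \<in> Der_stalk X A p"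
    "\<alpha> \<in> carrier ?O" "\<delta> ?F = \<alpha> \<otimes>\<^bsub>?O\<^esub> ?F" if "(\<delta>, \<alpha>) \<in> \<Lambda>" for \<delta> \<alpha>
    using that subsetD[OF Der_stalk_subset[of X A p], of \<delta>]
    by (auto simp: \<Lambda>_def Der_stalk_in_D_stalk mult_op_in_D_stalk)
  have \<theta>_closed: "\<theta> \<delta> \<alpha> \<in> carrier ?S" if "(\<delta>, \<alpha>) \<in> \<Lambda>" for \<delta> \<alpha>
    using \<Lambda>D[OF that] s by (simp add: \<theta>_def \<iota>_closed)
  have coeff_\<theta>: "coeff ?S (\<theta> \<delta> \<alpha>) 0 = \<delta>" if "(\<delta>, \<alpha>) \<in> \<Lambda>" for \<delta> \<alpha>
  proof -
    interpret c: ring_hom_ring ?S ?D "\<lambda>q. coeff ?S q 0"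
      by (rule ring_hom_ringI2[OF D.UP_ring ring_D_stalk[OF p] D.coeff_0_hom])
    have "coeff ?S (\<theta> \<delta> \<alpha>) 0 = coeff ?S (\<iota> \<delta>) 0 \<ominus>\<^bsub>?D\<^esub> coeff ?S (\<iota> (?m \<alpha>)) 0 \<otimes>\<^bsub>?D\<^esub> coeff ?S ?s 0"
      using \<Lambda>D[OF that] s \<iota>_closed unfolding \<theta>_def a_minus_def
      by (simp only: c.hom_add c.hom_a_inv c.hom_mult D.P.a_inv_closed D.P.m_closed)
    also have "\<dots> = \<delta> \<ominus>\<^bsub>?D\<^esub> ?m \<alpha> \<otimes>\<^bsub>?D\<^esub> \<zero>\<^bsub>?D\<^esub>"
      using \<Lambda>D[OF that] by (simp add: \<iota>_eq s_elem_def del: D_stalk_ops)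
    also have "\<dots> = \<delta>"
      using \<Lambda>D[OF that] by (simp add: a_minus_def del: D_stalk_ops)
    finally show ?thesis .
  qed
  have unique: "\<alpha> = \<beta>" if "(\<delta>, \<alpha>) \<in> \<Lambda>" "(\<delta>, \<beta>) \<in> \<Lambda>" for \<delta> \<alpha> \<beta>
  proof -
    have ab: "\<alpha> \<in> carrier ?O" "\<beta> \<in> carrier ?O" "\<alpha> \<otimes>\<^bsub>?O\<^esub> ?F = \<beta> \<otimes>\<^bsub>?O\<^esub> ?F"
      using \<Lambda>D[OF that(1)] \<Lambda>D[OF that(2)] by simp_all
    have "(\<alpha> \<ominus>\<^bsub>?O\<^esub> \<beta>) \<otimes>\<^bsub>?O\<^esub> ?F = \<alpha> \<otimes>\<^bsub>?O\<^esub> ?F \<ominus>\<^bsub>?O\<^esub> \<beta> \<otimes>\<^bsub>?O\<^esub> ?F"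
      using ab(1,2) F by (simp add: a_minus_def O.l_distr O.l_minus)
    also have "\<dots> = \<zero>\<^bsub>?O\<^esub>"
      unfolding ab(3) using ab(2) F by (simp add: O.r_right_minus_eq)
    finally have zero: "(\<alpha> \<ominus>\<^bsub>?O\<^esub> \<beta>) \<otimes>\<^bsub>?O\<^esub> ?F = \<zero>\<^bsub>?O\<^esub>" .
    have "\<alpha> \<ominus>\<^bsub>?O\<^esub> \<beta> = \<zero>\<^bsub>?O\<^esub>"
      by (rule germ_f_regular[OF X D fD p O.minus_closed[OF ab(1,2)] zero])
    then show ?thesis using ab(1,2) by (simp add: O.r_right_minus_eq)
  qed
  have \<Lambda>_add: "(\<delta> \<oplus>\<^bsub>?D\<^esub> \<eta>, \<alpha> \<oplus>\<^bsub>?O\<^esub> \<beta>) \<in> \<Lambda>" if "(\<delta>, \<alpha>) \<in> \<Lambda>" "(\<eta>, \<beta>) \<in> \<Lambda>" for \<delta> \<alpha> \<eta> \<beta>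
    using \<Lambda>D[OF that(1)] \<Lambda>D[OF that(2)] F
    by (simp add: \<Lambda>_def Der_stalk_add End_stalk_apply O.l_distr)
  have \<theta>_add: "\<theta> \<delta> \<alpha> \<oplus>\<^bsub>?S\<^esub> \<theta> \<eta> \<beta> = \<theta> (\<delta> \<oplus>\<^bsub>?D\<^esub> \<eta>) (\<alpha> \<oplus>\<^bsub>?O\<^esub> \<beta>)"
    if "(\<delta>, \<alpha>) \<in> \<Lambda>" "(\<eta>, \<beta>) \<in> \<Lambda>" for \<delta> \<alpha> \<eta> \<beta>
  proof -
    note d = \<Lambda>D[OF that(1)] and e = \<Lambda>D[OF that(2)]
    have "?m (\<alpha> \<oplus>\<^bsub>?O\<^esub> \<beta>) = ?m \<alpha> \<oplus>\<^bsub>?D\<^esub> ?m \<beta>"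
      using mult_op_add[OF p d(5) e(5)] by simp
    then show ?thesis
      unfolding \<theta>_def
      by (simp only: ring_hom_add[OF \<iota>_hom d(1) e(1)] ring_hom_add[OF \<iota>_hom d(2) e(2)]
          D.P.diff_mult_add[OF \<iota>_closed[OF d(1)] \<iota>_closed[OF d(2)] \<iota>_closed[OF e(1)] \<iota>_closed[OF e(2)] s])
  qed
  have \<Lambda>_mult: "(?m a \<otimes>\<^bsub>?D\<^esub> \<delta>, a \<otimes>\<^bsub>?O\<^esub> \<alpha>) \<in> \<Lambda>" if "a \<in> carrier ?O" "(\<delta>, \<alpha>) \<in> \<Lambda>" for a \<delta> \<alpha>
    using \<Lambda>D[OF that(2)] that(1) F
    by (simp add: \<Lambda>_def Der_stalk_mult End_stalk_apply mult_op_app O.m_assoc)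
  have \<theta>_mult: "\<iota> (?m a) \<otimes>\<^bsub>?S\<^esub> \<theta> \<delta> \<alpha> = \<theta> (?m a \<otimes>\<^bsub>?D\<^esub> \<delta>) (a \<otimes>\<^bsub>?O\<^esub> \<alpha>)"
    if "a \<in> carrier ?O" "(\<delta>, \<alpha>) \<in> \<Lambda>" for a \<delta> \<alpha>
  proof -
    note d = \<Lambda>D[OF that(2)] and a = mult_op_in_D_stalk[OF that(1)]
    have "?m (a \<otimes>\<^bsub>?O\<^esub> \<alpha>) = ?m a \<otimes>\<^bsub>?D\<^esub> ?m \<alpha>"
      using mult_op_mult[OF p that(1) d(5)] by simp
    then show ?thesis
      unfolding \<theta>_def
      by (simp only: ring_hom_mult[OF \<iota>_hom a d(1)] ring_hom_mult[OF \<iota>_hom a d(2)]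
          D.P.mult_diff_mult[OF \<iota>_closed[OF a] \<iota>_closed[OF d(1)] \<iota>_closed[OF d(2)] s])
  qed
  have "s_deformation ?S ?D (?m ` carrier ?O) (Theta_stalk X A f p) (\<lambda>q. coeff ?S q 0) (\<lambda>b. monom ?S b 0)
      (monom ?S \<one>\<^bsub>?D\<^esub> 1) (\<lambda>q n. q (Suc n))"
  proof (rule UP_s_deformation[OF ring_D_stalk[OF p]])
    show "?m ` carrier ?O \<subseteq> carrier ?D" by (auto intro: mult_op_in_D_stalk)
    show "Theta_stalk X A f p \<subseteq> carrier ?S" unfolding Theta by (auto intro: \<theta>_closed)
    show "x \<oplus>\<^bsub>?S\<^esub> y \<in> Theta_stalk X A f p" if xy': "x \<in> Theta_stalk X A f p" "y \<in> Theta_stalk X A f p" for x y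
    proof -
      obtain \<delta> \<alpha> \<eta> \<beta> where xy: "(\<delta>, \<alpha>) \<in> \<Lambda>" "x = \<theta> \<delta> \<alpha>" "(\<eta>, \<beta>) \<in> \<Lambda>" "y = \<theta> \<eta> \<beta>"
        using xy'[THEN Theta_cases] by blast
      show ?thesis
        unfolding xy(2,4) \<theta>_add[OF xy(1,3)] by (rule ThetaI[OF \<Lambda>_add[OF xy(1,3)]])
    qed
    show "monom ?S b 0 \<otimes>\<^bsub>?S\<^esub> x \<in> Theta_stalk X A f p"
      if bx: "b \<in> ?m ` carrier ?O" "x \<in> Theta_stalk X A f p" for b x
    proof -
      obtain a \<delta> \<alpha> where x: "a \<in> carrier ?O" "b = ?m a" "(\<delta>, \<alpha>) \<in> \<Lambda>" "x = \<theta> \<delta> \<alpha>"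
        using bx(1) Theta_cases[OF bx(2)] by blast
      have "monom ?S b 0 \<otimes>\<^bsub>?S\<^esub> x = \<theta> (?m a \<otimes>\<^bsub>?D\<^esub> \<delta>) (a \<otimes>\<^bsub>?O\<^esub> \<alpha>)"
        using \<theta>_mult[OF x(1,3)] unfolding x(2,4) \<iota>_eq .
      then show ?thesis
        using ThetaI[OF \<Lambda>_mult[OF x(1,3)]] by (simp only:)
    qed
    show "inj_on (\<lambda>q. coeff ?S q 0) (Theta_stalk X A f p)"
    proof (rule inj_onI)
      fix x y assume xy': "x \<in> Theta_stalk X A f p" "y \<in> Theta_stalk X A f p"
        and eq: "coeff ?S x 0 = coeff ?S y 0"
      obtain \<delta> \<alpha> \<eta> \<beta> where xy: "(\<delta>, \<alpha>) \<in> \<Lambda>" "x = \<theta> \<delta> \<alpha>" "(\<eta>, \<beta>) \<in> \<Lambda>" "y = \<theta> \<eta> \<beta>"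
        using xy'[THEN Theta_cases] by blast
      have "\<delta> = \<eta>" using eq unfolding xy(2,4) coeff_\<theta>[OF xy(1)] coeff_\<theta>[OF xy(3)] .
      then show "x = y" using unique[of \<delta> \<alpha> \<beta>] xy by simp
    qed
  qed
  then show "s_deformation ?S ?D (?m ` carrier ?O) (Theta_stalk X A f p) (\<lambda>q. coeff ?S q 0)
      (const_s X A p) ?s (\<lambda>q n. q (Suc n))"
    unfolding \<iota>_eq[symmetric] s_elem_def[symmetric] unfolding \<iota>_def .
  have "(\<lambda>q. coeff ?S q 0) ` Theta_stalk X A f p = fst ` \<Lambda>"
    unfolding Theta image_image by (rule image_cong) (auto simp: coeff_\<theta>)
  also have "\<dots> = Der_log_stalk X A D p"
    unfolding Der_log_stalk_eq[OF f p] \<Lambda>_def by force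
  finally show "(\<lambda>q. coeff ?S q 0) ` Theta_stalk X A f p = Der_log_stalk X A D p" .
qed

theorem mainTheorem2:
  fixes X :: "'a topology" and A :: "('a, 'n::finite) chart set"
    and D :: "'a set" and f :: "'a \<Rightarrow> complex"
  assumes "complex_manifold X A"
    and "free_divisor X A D"
    and "reduced_equation X A D f"
    and "\<forall>r\<ge>1. Theta_spencer_exact X A f r"
  shows "(log_spencer_exact X A D 1 \<longleftrightarrow> no_s_torsion X A f) \<and>
         (no_s_torsion X A f \<longleftrightarrow> pre_Spencer X A D)"
proof -
  let ?exact = "\<lambda>p. spencer_exact (D_stalk X A p) (mult_op X A p ` carrier (O_stalk X A p))
      (Der_log_stalk X A D p)"
  have stalk: "?exact p 1 \<longleftrightarrow> no_torsion (Ds_stalk X A p)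
        (left_ideal_gen (Ds_stalk X A p) (Theta_stalk X A f p)) (s_elem X A p)"
    and above: "r \<ge> 2 \<Longrightarrow> ?exact p r" if p: "p \<in> topspace X" for p r
  proof -
    have D: "hypersurface X A D" using assms(2) by (simp add: free_divisor_def)
    interpret s_deformation "Ds_stalk X A p" "D_stalk X A p" "mult_op X A p ` carrier (O_stalk X A p)"
      "Theta_stalk X A f p" "\<lambda>q. coeff (Ds_stalk X A p) q 0" "const_s X A p" "s_elem X A p"
      "\<lambda>q n. q (Suc n)"
      by (rule s_deformation_stalk(1)[OF assms(1) D assms(3) p])
    note image = s_deformation_stalk(2)[OF assms(1) D assms(3) p]
    have exact_S: "spencer_exact (Ds_stalk X A p) (const_s X A p ` mult_op X A p ` carrier (O_stalk X A p))
        (Theta_stalk X A f p) r" if "r \<ge> 1" for r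
      using assms(4) that p by (simp add: Theta_spencer_exact_def image_image)
    show "?exact p 1 \<longleftrightarrow> no_torsion (Ds_stalk X A p)
        (left_ideal_gen (Ds_stalk X A p) (Theta_stalk X A f p)) (s_elem X A p)"
      using exact_1_iff_no_torsion[OF exact_S] unfolding image .
    show "?exact p r" if "r \<ge> 2"
      using exact_above_1[OF exact_S that] unfolding image .
  qed
  have "log_spencer_exact X A D 1 \<longleftrightarrow> no_s_torsion X A f"
    unfolding log_spencer_exact_def no_s_torsion_def using stalk by blast
  moreover have high: "log_spencer_exact X A D r" if "r \<ge> 2" for r
    unfolding log_spencer_exact_def using above[OF _ that] by blast
  have "(\<forall>r\<ge>1. log_spencer_exact X A D r) \<longleftrightarrow> log_spencer_exact X A D 1"
  proof (intro iffI allI impI)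
    fix r :: nat assume "log_spencer_exact X A D 1" "r \<ge> 1"
    then show "log_spencer_exact X A D r"
      using high[of r] by (cases "r = 1") auto
  qed simp
  then have "pre_Spencer X A D \<longleftrightarrow> log_spencer_exact X A D 1"
    unfolding pre_Spencer_def using assms(2) by blast
  ultimately show ?thesis by blast
qed

end
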